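(* Let $\mathrm{M}$ be a matroid on $[n]=\{1,\dots,n\}$, let $\mathrm{N}$ be a matroid on a finite set $F$, and let $f:\mathrm{M}\to\mathrm{N}$ be a morphism of matroids. For any positive real numbers $p\le1$ and $q\le1$, the homogeneous polynomial of degree $n$ in $n+1$ variables $$\mathrm{Z}_{p,q,f}(w_0,w_1,\ldots,w_n):=\sum_{S\subseteq[n]}p^{-\operatorname{rk}_{\mathrm{M}}(S)}\,q^{-\operatorname{rk}_{\mathrm{N}}(f(S))}\,w_0^{\,n-|S|}\prod_{i\in S}w_i$$ is Lorentzian.
   Context: A matroid $\mathrm{M}$ on a finite set $E$ is given by its rank function $\operatorname{rk}_{\mathrm{M}}:2^E\to\mathbb{N}$ (with $\operatorname{rk}_{\mathrm M}(S)\le|S|$, monotone, submodular). A morphism $f:\mathrm{M}\to\mathrm{N}$ between matroids $\mathrm{M}$ on $E$ and $\mathrm{N}$ on $F$ is a function $f:E\to F$ such that $\operatorname{rk}_{\mathrm{N}}(f(S_2))-\operatorname{rk}_{\mathrm{N}}(f(S_1))\le\operatorname{rk}_{\mathrm{M}}(S_2)-\operatorname{rk}_{\mathrm{M}}(S_1)$ for all $S_1\subseteq S_2\subseteq E$. Lorentzian polynomials: a homogeneous polynomial $h$ of degree $d$ with real coefficients in a finite set of variables $w_i$ is strictly Lorentzian if all of its coefficients (i.e. those of all degree-$d$ monomials in the variables) are positive and, for any indices $i_1,\ldots,i_{d-2}$, the quadratic form $\partial_{i_1}\cdots\partial_{i_{d-2}}h$ has the Lorentzian signature $(+,-,\ldots,-)$,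 where $\partial_i=\partial/\partial w_i$ (this second condition is vacuous when $d<2$). Lorentzian polynomials are the polynomials that can be obtained as a limit of strictly Lorentzian polynomials (of the same degree in the same variables). *)

theory Defs
  imports
    Complex_Main
    "HOL-Library.Poly_Mapping"
    "Jordan_Normal_Form.Matrix"
begin

section \<open>Matroids and their morphisms\<close>

locale matroid =
  fixes E :: "'a set" and rk :: "'a set \<Rightarrow> nat"
  assumes finite_ground: "finite E"
    and rk_le_card: "S \<subseteq> E \<Longrightarrow> rk S \<le> card S"
    and rk_mono: "S \<subseteq> T \<Longrightarrow> T \<subseteq> E \<Longrightarrow> rk S \<le> rk T"
    and rk_submodular:
      "S \<subseteq> E \<Longrightarrow> T \<subseteq> E \<Longrightarrow> rk (S \<union> T) + rk (S \<inter> T) \<le> rk S + rk T"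

locale matroid_morphism =
  M: matroid E rk\<^sub>M + N: matroid F rk\<^sub>N
  for E :: "'a set" and rk\<^sub>M :: "'a set \<Rightarrow> nat"
    and F :: "'b set" and rk\<^sub>N :: "'b set \<Rightarrow> nat" +
  fixes f :: "'a \<Rightarrow> 'b"
  assumes maps_to: "f ` E \<subseteq> F"
    and rk_diff: "S\<^sub>1 \<subseteq> S\<^sub>2 \<Longrightarrow> S\<^sub>2 \<subseteq> E \<Longrightarrow>
      int (rk\<^sub>N (f ` S\<^sub>2)) - int (rk\<^sub>N (f ` S\<^sub>1)) \<le> int (rk\<^sub>M S\<^sub>2) - int (rk\<^sub>M S\<^sub>1)"


section \<open>Multivariate polynomials\<close>

text \<open>
  A monomial is its finitely supported exponent vector, a polynomial its finitely supported
  coefficient function; multiplication is the convolution of \<^theory>\<open>HOL-Library.Poly_Mapping\<close>.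
  Variables are \<open>w\<^sub>0, w\<^sub>1, \<dots>\<close>, and a polynomial in \<open>N\<close> variables is one in \<open>w\<^sub>0, \<dots>, w\<^sub>N\<^sub>-\<^sub>1\<close>.
\<close>

type_synonym monomial = "nat \<Rightarrow>\<^sub>0 nat"
type_synonym real_mpoly = "monomial \<Rightarrow>\<^sub>0 real"

abbreviation coeff :: "real_mpoly \<Rightarrow> monomial \<Rightarrow> real" where
  "coeff h m \<equiv> Poly_Mapping.lookup h m"

definition Const :: "real \<Rightarrow> real_mpoly" where
  "Const c = Poly_Mapping.single 0 c"

definition Var :: "nat \<Rightarrow> real_mpoly" where
  "Var i = Poly_Mapping.single (Poly_Mapping.single i 1) 1"

definition monomials :: "nat \<Rightarrow> nat \<Rightarrow> monomial set" where
  "monomials N d = {m. Poly_Mapping.keys m \<subseteq> {..<N} \<and>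
     (\<Sum>i\<in>Poly_Mapping.keys m. Poly_Mapping.lookup m i) = d}"

definition homogeneous :: "nat \<Rightarrow> nat \<Rightarrow> real_mpoly \<Rightarrow> bool" where
  "homogeneous N d h \<longleftrightarrow> Poly_Mapping.keys h \<subseteq> monomials N d"

text \<open>
  If \<open>w\<^sub>i\<close> does not occur in \<open>m\<close>, the truncated difference \<open>m - single i 1\<close> is \<open>m\<close> itself, but
  the coefficient is then zero.
\<close>

definition pdiff :: "nat \<Rightarrow> real_mpoly \<Rightarrow> real_mpoly" where
  "pdiff i h = (\<Sum>m\<in>Poly_Mapping.keys h.
     Poly_Mapping.single (m - Poly_Mapping.single i 1)
       (of_nat (Poly_Mapping.lookup m i) * coeff h m))"

lemma lookup_pdiff:
  "coeff (pdiff i h) m =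
     of_nat (Suc (Poly_Mapping.lookup m i)) * coeff h (m + Poly_Mapping.single i 1)"
proof -
  let ?s = "Poly_Mapping.single i (1::nat)"
  have eq: "(of_nat (Poly_Mapping.lookup m' i) * coeff h m' when m' - ?s = m) =
      (of_nat (Suc (Poly_Mapping.lookup m i)) * coeff h (m + ?s) when m' = m + ?s)" for m'
  proof (cases "Poly_Mapping.lookup m' i = 0")
    case True
    then have "m' \<noteq> m + ?s" by (auto simp: lookup_add)
    with True show ?thesis by simp
  next
    case False
    then have "m' = (m' - ?s) + ?s"
      by (intro poly_mapping_eqI) (auto simp: lookup_add lookup_minus lookup_single when_def)
    then have "m' - ?s = m \<longleftrightarrow> m' = m + ?s" by (metis add_diff_cancel_right')
    then show ?thesis by (auto simp: when_def lookup_add)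
  qed
  have "coeff (pdiff i h) m = (\<Sum>m'\<in>Poly_Mapping.keys h.
      (of_nat (Suc (Poly_Mapping.lookup m i)) * coeff h (m + ?s) when m' = m + ?s))"
    unfolding pdiff_def lookup_sum lookup_single by (simp only: eq)
  also have "\<dots> = of_nat (Suc (Poly_Mapping.lookup m i)) * coeff h (m + ?s)"
    by (simp add: when_def in_keys_iff)
  finally show ?thesis .
qed


section \<open>Lorentzian polynomials\<close>

text \<open>
  The symmetric matrix \<open>A\<close> with \<open>q(w) = \<Sum>\<^sub>i\<^sub>,\<^sub>j A\<^sub>i\<^sub>j w\<^sub>i w\<^sub>j\<close>; the second derivatives of a
  quadratic form \<open>q\<close> are constants.
\<close>

definition gram_mat :: "nat \<Rightarrow> real_mpoly \<Rightarrow> real mat" where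
  "gram_mat N q = mat N N (\<lambda>(i, j). coeff (pdiff i (pdiff j q)) 0 / 2)"

text \<open>
  A quadratic form \<open>q\<close> in \<open>N\<close> variables has \<open>r\<close> plus signs, \<open>s\<close> minus signs and
  \<open>N - r - s\<close> zeros if an invertible linear change of variables turns it into
  \<open>x\<^sub>0\<^sup>2 + \<dots> - x\<^sub>r\<^sup>2 - \<dots>\<close>.
\<close>

definition has_signature :: "nat \<Rightarrow> real_mpoly \<Rightarrow> nat \<Rightarrow> nat \<Rightarrow> bool" where
  "has_signature N q r s \<longleftrightarrow> r + s \<le> N \<and>
     (\<exists>P \<in> carrier_mat N N. invertible_mat P \<and>
        transpose_mat P * gram_mat N q * P =
          mat_diag N (\<lambda>i. if i < r then 1 else if i < r + s then -1 else 0))"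

definition strictly_lorentzian :: "nat \<Rightarrow> nat \<Rightarrow> real_mpoly \<Rightarrow> bool" where
  "strictly_lorentzian N d h \<longleftrightarrow>
     homogeneous N d h \<and>
     (\<forall>m \<in> monomials N d. coeff h m > 0) \<and>
     (\<forall>is. length is + 2 = d \<longrightarrow> set is \<subseteq> {..<N} \<longrightarrow>
        has_signature N (foldr pdiff is h) 1 (N - 1))"

text \<open>
  All strictly Lorentzian polynomials considered lie in the finite-dimensional space of forms of
  degree \<open>d\<close> in \<open>N\<close> variables, where convergence is convergence of coefficients. The limit is
  again homogeneous of degree \<open>d\<close> in these variables.
\<close>

definition lorentzian :: "nat \<Rightarrow> nat \<Rightarrow> real_mpoly \<Rightarrow> bool" where
  "lorentzian N d h \<longleftrightarrow>
     (\<exists>H :: nat \<Rightarrow> real_mpoly. (\<forall>k. strictly_lorentzian N d (H k)) \<and>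
        (\<forall>m. (\<lambda>k. coeff (H k) m) \<longlonglongrightarrow> coeff h m))"

lemma lorentzian_imp_homogeneous:
  assumes "lorentzian N d h"
  shows "homogeneous N d h"
  unfolding homogeneous_def
proof
  fix m assume m: "m \<in> Poly_Mapping.keys h"
  from assms obtain H where H: "\<And>k. strictly_lorentzian N d (H k)"
    and lim: "(\<lambda>k. coeff (H k) m) \<longlonglongrightarrow> coeff h m"
    unfolding lorentzian_def by blast
  show "m \<in> monomials N d"
  proof (rule ccontr)
    assume "m \<notin> monomials N d"
    then have "coeff (H k) m = 0" for k
      using H[of k] by (auto simp: strictly_lorentzian_def homogeneous_def in_keys_iff)
    with lim have "coeff h m = 0" by (simp add: LIMSEQ_const_iff)
    with m show False by (simp add: in_keys_iff)
  qed
qed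


section \<open>The partition function of a morphism\<close>

definition Z_morphism ::
  "real \<Rightarrow> real \<Rightarrow> nat \<Rightarrow> (nat set \<Rightarrow> nat) \<Rightarrow> ('b set \<Rightarrow> nat) \<Rightarrow> (nat \<Rightarrow> 'b) \<Rightarrow> real_mpoly" where
  "Z_morphism p q n rk\<^sub>M rk\<^sub>N f =
     (\<Sum>S \<in> Pow {1..n}.
        Const (p powi (- int (rk\<^sub>M S)) * q powi (- int (rk\<^sub>N (f ` S)))) *
          Var 0 ^ (n - card S) * (\<Prod>i\<in>S. Var i))"

end

theory Submission
  imports Defs "Jordan_Normal_Form.Determinant"
begin

text \<open>
  A form \<open>h\<close> of degree \<open>n\<close> is handled through its normalized coefficients \<open>m! h\<^sub>m\<close>: on these,
  \<open>\<partial>\<^sub>i\<close> is the shift of exponents by \<open>e\<^sub>i\<close>, and a quadratic form becomes the matrix of its second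
  derivatives. A symmetric matrix is called hyperbolic if it has at most one positive eigenvalue.

  \<^bold>\<open>Coordinate derivatives.\<close> An iterated derivative \<open>\<partial>\<^sup>\<alpha> Z\<close> of degree two vanishes unless \<open>\<alpha>\<close> is
  \<open>k\<close> times \<open>w\<^sub>0\<close> plus a set \<open>T\<close>. Completing the square in \<open>w\<^sub>0\<close> then turns hyperbolicity into
  \<open>(\<Sum> z\<^sub>i)\<^sup>2 \<le> |R| \<Sum> K\<^sub>i\<^sub>j z\<^sub>i z\<^sub>j\<close> on the complement \<open>R\<close> of \<open>T\<close>, where \<open>K\<^sub>i\<^sub>i = 1\<close> and, for distinct
  \<open>i\<close> and \<open>j\<close>, \<open>1 - K\<^sub>i\<^sub>j\<close> is the product of a factor \<open>p\<close> if \<open>i\<close> and \<open>j\<close> are parallel in \<open>M / T\<close> and a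
  factor \<open>q\<close> if \<open>f i\<close> and \<open>f j\<close> are parallel in \<open>N / f(T)\<close>. Since \<open>f\<close> is a morphism, the union of
  these two relations is again transitive. So \<open>K\<close> is a convex combination of the indicator matrices
  of four equivalence relations on \<open>R\<close> (both relations, each one, none), and for a single equivalence
  relation the inequality is Cauchy-Schwarz over its classes, of which there are at most \<open>|R|\<close>
  (\<open>sum_sq_le_correlation\<close>, \<open>hyperbolic_Q\<close>).

  \<^bold>\<open>Positive directions.\<close> If \<open>g\<close> is cubic with nonnegative coefficients and all \<open>\<partial>\<^sub>i g\<close> are
  hyperbolic, then so is \<open>D\<^sub>a g\<close> for every positive vector \<open>a\<close>, provided that the Hessian is
  connected. Indeed, summing the reverse Cauchy-Schwarz inequalities for \<open>\<partial>\<^sub>i g\<close> with weights \<open>a\<^sub>i\<close>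
  shows that a reversible random walk \<open>B\<close> built from the Hessian of \<open>D\<^sub>a g\<close> satisfies \<open>B \<le> B\<^sup>2\<close>. Its
  eigenvalues are then at most \<open>0\<close> or at least \<open>1\<close>, and connectedness leaves the eigenvalue \<open>1\<close> only
  to the constants (\<open>trickle_down\<close>). Connectedness comes from \<open>w\<^sub>0\<close>: replacing a variable of a
  monomial of \<open>Z\<close> by \<open>w\<^sub>0\<close> gives a monomial of \<open>Z\<close>. As derivatives commute, coordinate directions
  can be exchanged for positive ones one at a time (\<open>strictly_hyperbolic_iterated_dirderiv\<close>).

  \<^bold>\<open>Strictness.\<close> Multiplying the coefficient of \<open>w\<^sub>0\<^sup>n\<close> by some \<open>s < 1\<close> makes \<open>\<partial>\<^sub>0\<^sup>n\<^sup>-\<^sup>2 Z\<close>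
  nondegenerate, and this passes to all derivatives of degree two in positive directions. The
  substitution \<open>w\<^sub>k \<mapsto> w\<^sub>k + \<epsilon> \<Sum>\<^sub>i w\<^sub>i\<close> replaces
  coordinate directions by the positive vectors \<open>e\<^sub>i + \<epsilon> (1, \<dots>, 1)\<close>, so it yields a strictly
  Lorentzian polynomial (\<open>strictly_lorentzian_substitute\<close>). Finally \<open>s \<longlonglongrightarrow> 1\<close> and
  \<open>\<epsilon> \<longlonglongrightarrow> 0\<close>.
\<close>

section \<open>Symmetric forms with at most one positive direction\<close>

definition bilin :: "nat \<Rightarrow> (nat \<Rightarrow> nat \<Rightarrow> real) \<Rightarrow> (nat \<Rightarrow> real) \<Rightarrow> (nat \<Rightarrow> real) \<Rightarrow> real" where
  "bilin N Q x y = (\<Sum>i<N. \<Sum>j<N. Q i j * x i * y j)"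

definition symmetric :: "nat \<Rightarrow> (nat \<Rightarrow> nat \<Rightarrow> real) \<Rightarrow> bool" where
  "symmetric N Q \<longleftrightarrow> (\<forall>i<N. \<forall>j<N. Q i j = Q j i)"

text \<open>
  For symmetric \<open>Q\<close> this says that the form is positive definite on no plane, that is, it has at most
  one positive eigenvalue.
\<close>

definition hyperbolic :: "nat \<Rightarrow> (nat \<Rightarrow> nat \<Rightarrow> real) \<Rightarrow> bool" where
  "hyperbolic N Q \<longleftrightarrow> (\<forall>x y. bilin N Q y y > 0 \<longrightarrow> bilin N Q x y = 0 \<longrightarrow> bilin N Q x x \<le> 0)"

text \<open>
  For symmetric \<open>Q\<close> whose form takes a positive value this is the signature \<open>(+, -, \<dots>, -)\<close>; it
  holds vacuously if the form takes no positive value. Vectors matter only through their first \<open>N\<close>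
  entries, hence the form of the nonzero condition.
\<close>

definition strictly_hyperbolic :: "nat \<Rightarrow> (nat \<Rightarrow> nat \<Rightarrow> real) \<Rightarrow> bool" where
  "strictly_hyperbolic N Q \<longleftrightarrow>
     (\<forall>x y. bilin N Q y y > 0 \<longrightarrow> bilin N Q x y = 0 \<longrightarrow> (\<exists>i<N. x i \<noteq> 0) \<longrightarrow> bilin N Q x x < 0)"

lemma bilin_lin_left:
  "bilin N Q (\<lambda>i. c * x i + d * y i) z = c * bilin N Q x z + d * bilin N Q y z"
  by (simp add: bilin_def sum.distrib sum_distrib_left algebra_simps)

lemma bilin_lin_right:
  "bilin N Q z (\<lambda>i. c * x i + d * y i) = c * bilin N Q z x + d * bilin N Q z y"
  by (simp add: bilin_def sum.distrib sum_distrib_left algebra_simps)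

lemma bilin_scale:
  "bilin N Q (\<lambda>i. c * x i) y = c * bilin N Q x y" "bilin N Q x (\<lambda>i. c * y i) = c * bilin N Q x y"
  using bilin_lin_left[of N Q c x 0 x y] bilin_lin_right[of N Q x c y 0 y] by simp_all

lemma bilin_commute:
  assumes "symmetric N Q"
  shows "bilin N Q x y = bilin N Q y x"
proof -
  have "bilin N Q x y = (\<Sum>i<N. \<Sum>j<N. Q j i * x i * y j)"
    unfolding bilin_def using assms by (intro sum.cong refl) (auto simp: symmetric_def)
  also have "\<dots> = (\<Sum>j<N. \<Sum>i<N. Q j i * x i * y j)"
    by (rule sum.swap)
  also have "\<dots> = bilin N Q y x"
    unfolding bilin_def by (simp add: mult_ac)
  finally show ?thesis .
qed

lemma bilin_cong:
  assumes "\<And>i. i < N \<Longrightarrow> x i = x' i" "\<And>i. i < N \<Longrightarrow> y i = y' i"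
  shows "bilin N Q x y = bilin N Q x' y'"
  unfolding bilin_def using assms by (intro sum.cong refl) auto

lemma bilin_e0:
  assumes "0 < N"
  shows "bilin N Q (\<lambda>i. of_bool (i = 0)) (\<lambda>i. of_bool (i = 0)) = Q 0 0"
proof -
  have "{..<N} = insert 0 {1..<N}" using assms by auto
  then show ?thesis by (simp add: bilin_def)
qed

lemma bilin_quadratic:
  assumes "symmetric N Q"
  shows "bilin N Q (\<lambda>i. c * x i + d * y i) (\<lambda>i. c * x i + d * y i) =
    c\<^sup>2 * bilin N Q x x + 2 * c * d * bilin N Q x y + d\<^sup>2 * bilin N Q y y"
  using bilin_commute[OF assms, of y x]
  by (simp add: bilin_lin_left bilin_lin_right power2_eq_square algebra_simps)

lemma bilin_zero_if_positive_zero: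
  assumes "\<And>i j. i < N \<Longrightarrow> j < N \<Longrightarrow> 0 \<le> Q i j" and a: "\<And>i. i < N \<Longrightarrow> a i > 0"
    and "bilin N Q a a \<le> 0"
  shows "bilin N Q x y = 0"
proof -
  have nn: "0 \<le> Q i j * a i * a j" if "i < N" "j < N" for i j
    using assms(1)[OF that] a[OF that(1)] a[OF that(2)] by simp
  have "Q i j = 0" if ij: "i < N" "j < N" for i j
  proof -
    have "Q i j * a i * a j \<le> (\<Sum>j<N. Q i j * a i * a j)"
      using ij nn by (intro member_le_sum) auto
    also have "\<dots> \<le> bilin N Q a a"
      unfolding bilin_def using ij nn
      by (intro member_le_sum[of i _ "\<lambda>i. \<Sum>j<N. Q i j * a i * a j"] sum_nonneg) auto
    finally have "Q i j * a i * a j = 0"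
      using assms(3) nn[OF ij] by linarith
    then show ?thesis using a[OF ij(1)] a[OF ij(2)] by simp
  qed
  then show ?thesis by (simp add: bilin_def)
qed

text \<open>
  Eliminating the variable \<open>x\<^sub>0\<close>: on the orthogonal complement of \<open>e\<^sub>0\<close> the form is the Schur
  complement of the entry \<open>Q\<^sub>0\<^sub>0\<close>.
\<close>

lemma bilin_complete_square:
  assumes sym: "symmetric (Suc n) Q" and "bilin (Suc n) Q x (\<lambda>i. of_bool (i = 0)) = 0"
  shows "Q 0 0 * bilin (Suc n) Q x x =
    Q 0 0 * (\<Sum>i\<in>{1..n}. \<Sum>j\<in>{1..n}. Q i j * x i * x j) - (\<Sum>i\<in>{1..n}. Q 0 i * x i)\<^sup>2"
    and "Q 0 0 * x 0 = - (\<Sum>i\<in>{1..n}. Q 0 i * x i)"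
proof -
  have "{..<Suc n} = insert 0 {1..n}" by auto
  then have split: "(\<Sum>i<Suc n. f i) = f 0 + (\<Sum>i\<in>{1..n}. f i)" for f :: "nat \<Rightarrow> real"
    by simp
  have Q: "Q i 0 = Q 0 i" if "i \<in> {1..n}" for i
    using sym that by (auto simp: symmetric_def)
  let ?L = "\<Sum>i\<in>{1..n}. Q 0 i * x i"
  let ?S = "\<Sum>i\<in>{1..n}. \<Sum>j\<in>{1..n}. Q i j * x i * x j"
  have "(\<Sum>i\<in>{1..n}. Q i 0 * x i * x 0) = x 0 * ?L"
    unfolding sum_distrib_left using Q by (intro sum.cong refl) auto
  moreover have "(\<Sum>j\<in>{1..n}. Q 0 j * x 0 * x j) = x 0 * ?L"
    by (simp add: sum_distrib_left mult_ac)
  ultimately have xx: "bilin (Suc n) Q x x = Q 0 0 * x 0 * x 0 + 2 * (x 0 * ?L) + ?S"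
    unfolding bilin_def split sum.distrib by simp
  have "bilin (Suc n) Q x (\<lambda>i. of_bool (i = 0)) = Q 0 0 * x 0 + (\<Sum>i\<in>{1..n}. Q i 0 * x i)"
    unfolding bilin_def split by simp
  also have "(\<Sum>i\<in>{1..n}. Q i 0 * x i) = ?L"
    using Q by (intro sum.cong refl) auto
  finally show x0: "Q 0 0 * x 0 = - ?L" using assms(2) by linarith
  have "Q 0 0 * bilin (Suc n) Q x x = (Q 0 0 * x 0)\<^sup>2 + 2 * (Q 0 0 * x 0) * ?L + Q 0 0 * ?S"
    unfolding xx by (simp add: power2_eq_square algebra_simps)
  then show "Q 0 0 * bilin (Suc n) Q x x = Q 0 0 * ?S - ?L\<^sup>2"
    unfolding x0 by (simp add: power2_eq_square algebra_simps)
qed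

text \<open>
  A single positive vector \<open>a\<close> is enough for the test. If \<open>x\<close> is orthogonal to another positive vector
  \<open>b\<close>, then the span of \<open>x\<close> and \<open>b\<close> meets the complement of \<open>a\<close>, and there the form is nonpositive,
  which prevents \<open>x\<close> from being positive too.
\<close>

lemma hyperbolic_if_complement_nonpos:
  assumes sym: "symmetric N Q" and a: "bilin N Q a a > 0"
    and neg: "\<And>x. bilin N Q x a = 0 \<Longrightarrow> bilin N Q x x \<le> 0"
  shows "hyperbolic N Q"
  unfolding hyperbolic_def
proof (intro allI impI)
  fix x b assume b: "bilin N Q b b > 0" and xb: "bilin N Q x b = 0"
  let ?y = "\<lambda>i. bilin N Q b a * x i + (- bilin N Q x a) * b i"
  have "bilin N Q ?y a = 0"
    by (simp only: bilin_lin_left) simp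
  then have "bilin N Q ?y ?y \<le> 0" by (rule neg)
  then have le: "(bilin N Q b a)\<^sup>2 * bilin N Q x x + (bilin N Q x a)\<^sup>2 * bilin N Q b b \<le> 0"
    by (simp only: bilin_quadratic[OF sym] xb) simp
  have "bilin N Q b a \<noteq> 0" using neg[of b] b by force
  moreover have "0 \<le> (bilin N Q x a)\<^sup>2 * bilin N Q b b" using b by simp
  ultimately show "bilin N Q x x \<le> 0"
    using le by (smt (verit) mult_pos_pos zero_less_power2)
qed

lemma strictly_hyperbolic_if_complement_neg:
  assumes sym: "symmetric N Q" and a: "bilin N Q a a > 0"
    and neg: "\<And>x. bilin N Q x a = 0 \<Longrightarrow> \<exists>i<N. x i \<noteq> 0 \<Longrightarrow> bilin N Q x x < 0"
  shows "strictly_hyperbolic N Q"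
  unfolding strictly_hyperbolic_def
proof (intro allI impI)
  fix x b assume b: "bilin N Q b b > 0" and xb: "bilin N Q x b = 0" and x: "\<exists>i<N. x i \<noteq> 0"
  let ?y = "\<lambda>i. bilin N Q b a * x i + (- bilin N Q x a) * b i"
  have bnz: "\<exists>i<N. b i \<noteq> 0"
  proof (rule ccontr)
    assume "\<not> ?thesis"
    then have "bilin N Q b b = 0" by (simp add: bilin_def)
    with b show False by simp
  qed
  have ba: "bilin N Q b a \<noteq> 0" using neg[of b] b bnz by force
  have ya: "bilin N Q ?y a = 0"
    by (simp only: bilin_lin_left) simp
  have ynz: "\<exists>i<N. ?y i \<noteq> 0"
  proof (rule ccontr)
    assume "\<not> ?thesis"
    then have *: "bilin N Q b a * x i = bilin N Q x a * b i" if "i < N" for i using that by auto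
    have "bilin N Q x a \<noteq> 0" using x * ba by force
    moreover have "bilin N Q ?y b = bilin N Q (\<lambda>i. 0) b"
      by (rule bilin_cong) (auto simp: *)
    then have "bilin N Q x a * bilin N Q b b = 0"
      by (simp only: bilin_lin_left xb) (simp add: bilin_def)
    ultimately show False using b by simp
  qed
  have "bilin N Q ?y ?y < 0" by (rule neg[OF ya ynz])
  then have le: "(bilin N Q b a)\<^sup>2 * bilin N Q x x + (bilin N Q x a)\<^sup>2 * bilin N Q b b < 0"
    by (simp only: bilin_quadratic[OF sym] xb) simp
  moreover have "0 \<le> (bilin N Q x a)\<^sup>2 * bilin N Q b b" using b by simp
  ultimately have "(bilin N Q b a)\<^sup>2 * bilin N Q x x < 0" by linarith
  then show "bilin N Q x x < 0"
    by (simp add: mult_less_0_iff)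
qed

lemma reverse_cauchy_schwarz:
  assumes "symmetric N Q" "hyperbolic N Q" and y: "bilin N Q y y > 0"
  shows "bilin N Q x x * bilin N Q y y \<le> (bilin N Q x y)\<^sup>2"
proof -
  let ?z = "\<lambda>i. bilin N Q y y * x i + (- bilin N Q x y) * y i"
  have "bilin N Q ?z y = 0"
    by (simp only: bilin_lin_left) simp
  then have "bilin N Q ?z ?z \<le> 0" using assms(2) y unfolding hyperbolic_def by blast
  then have "bilin N Q y y * (bilin N Q x x * bilin N Q y y - (bilin N Q x y)\<^sup>2) \<le> 0"
    by (simp only: bilin_quadratic[OF assms(1)]) (simp add: power2_eq_square algebra_simps)
  with y show ?thesis by (simp add: mult_le_0_iff)
qed

lemma bilin_sum_left:
  assumes "finite I"
  shows "bilin N Q (\<lambda>k. \<Sum>i\<in>I. x i * a i k) y = (\<Sum>i\<in>I. x i * bilin N Q (a i) y)"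
  using assms
proof (induction I rule: finite_induct)
  case empty
  then show ?case by (simp add: bilin_def)
next
  case (insert i I)
  then show ?case
    using bilin_lin_left[of N Q "x i" "a i" 1 "\<lambda>k. \<Sum>i\<in>I. x i * a i k" y] by simp
qed

lemma bilin_sum_right:
  assumes "finite I"
  shows "bilin N Q y (\<lambda>k. \<Sum>i\<in>I. x i * a i k) = (\<Sum>i\<in>I. x i * bilin N Q y (a i))"
  using assms
proof (induction I rule: finite_induct)
  case empty
  then show ?case by (simp add: bilin_def)
next
  case (insert i I)
  then show ?case
    using bilin_lin_right[of N Q y "x i" "a i" 1 "\<lambda>k. \<Sum>i\<in>I. x i * a i k"] by simp
qed

lemma bilin_pullback:
  "bilin N (\<lambda>i j. c * bilin N Q (a i) (a j)) x y =
    c * bilin N Q (\<lambda>k. \<Sum>i<N. x i * a i k) (\<lambda>k. \<Sum>i<N. y i * a i k)"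
  unfolding bilin_sum_left[OF finite_lessThan] bilin_sum_right[OF finite_lessThan]
  by (simp add: bilin_def[of N "\<lambda>i j. c * bilin N Q (a i) (a j)"] sum_distrib_left mult_ac)

text \<open>
  A change of variables with injective matrix preserves strict hyperbolicity; row \<open>i\<close> of the matrix is
  the vector \<open>a i\<close>.
\<close>

lemma strictly_hyperbolic_pullback:
  assumes sh: "strictly_hyperbolic N Q" and c: "c > 0"
    and inj: "\<And>x. (\<And>k. k < N \<Longrightarrow> (\<Sum>i<N. x i * a i k) = 0) \<Longrightarrow> (\<And>i. i < N \<Longrightarrow> x i = 0)"
  shows "strictly_hyperbolic N (\<lambda>i j. c * bilin N Q (a i) (a j))"
  unfolding strictly_hyperbolic_def bilin_pullback
proof (intro allI impI)
  fix x y
  let ?A = "\<lambda>x k. \<Sum>i<N. x i * a i k"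
  assume "0 < c * bilin N Q (?A y) (?A y)" "c * bilin N Q (?A x) (?A y) = 0" "\<exists>i<N. x i \<noteq> 0"
  moreover have "\<exists>k<N. ?A x k \<noteq> 0"
    using inj[of x] \<open>\<exists>i<N. x i \<noteq> 0\<close> by blast
  ultimately have "bilin N Q (?A x) (?A x) < 0"
    using sh c unfolding strictly_hyperbolic_def by (auto simp: zero_less_mult_iff)
  then show "c * bilin N Q (?A x) (?A x) < 0" using c by (simp add: mult_less_0_iff)
qed


section \<open>A spectral criterion for weighted graphs\<close>

text \<open>
  An upper bound \<open>b\<close> for the quotients \<open>K x / S x\<close> improves to \<open>b (2 - b) / (3 - 2 b)\<close>, which is less
  than \<open>b\<close> on the whole interval \<open>(0, 1)\<close>. So the best bound cannot lie there.
\<close>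

lemma contraction_nonpos:
  fixes K :: "'v \<Rightarrow> real" and S :: "'v \<Rightarrow> real"
  assumes pos: "\<And>x. x \<in> V \<Longrightarrow> 0 \<le> S x"
    and start: "\<And>x. x \<in> V \<Longrightarrow> K x \<le> b * S x" "b < 1"
    and improve: "\<And>x b. x \<in> V \<Longrightarrow> 0 < b \<Longrightarrow> b < 1 \<Longrightarrow> (\<And>y. y \<in> V \<Longrightarrow> K y \<le> b * S y) \<Longrightarrow>
        (3 - 2 * b) * K x \<le> b * (2 - b) * S x"
    and x: "x \<in> V"
  shows "K x \<le> 0"
proof (rule ccontr)
  assume Kx: "\<not> K x \<le> 0"
  then have Sx: "S x > 0" using start(1)[OF x] pos[OF x] by (metis less_eq_real_def mult_zero_right)
  define T where "T = {c. \<forall>y\<in>V. K y \<le> c * S y}"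
  have low: "K x / S x \<le> c" if "c \<in> T" for c
    using that x Sx by (auto simp: T_def field_simps)
  have bT: "b \<in> T" using start(1) by (auto simp: T_def)
  have bdd: "bdd_below T" using low by (rule bdd_belowI)
  define c where "c = Inf T"
  have "K x / S x \<le> c" unfolding c_def using bT low by (intro cInf_greatest) auto
  moreover have "K x / S x > 0" using Kx Sx by simp
  ultimately have c0: "c > 0" by linarith
  have c1: "c < 1" using cInf_lower[OF bT bdd] start(2) c_def by simp
  have cT: "K y \<le> c * S y" if y: "y \<in> V" for y
  proof (cases "S y = 0")
    case True
    then show ?thesis using start(1)[OF y] by simp
  next
    case False
    then have Sy: "S y > 0" using pos[OF y] by simp
    have "K y / S y \<le> c"
      unfolding c_def using bT y Sy by (intro cInf_greatest) (auto simp: T_def field_simps)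
    then show ?thesis using Sy by (simp add: field_simps)
  qed
  have d: "3 - 2 * c > 0" using c1 by simp
  have "c * (2 - c) / (3 - 2 * c) \<in> T"
    unfolding T_def using improve[OF _ c0 c1 cT] d by (auto simp: field_simps)
  then have "c \<le> c * (2 - c) / (3 - 2 * c)" unfolding c_def using bdd by (rule cInf_lower)
  then have "c * (3 - 2 * c) \<le> c * (2 - c)" using d by (simp add: field_simps)
  then have "3 - 2 * c \<le> 2 - c" using c0 by simp
  then show False using c1 by simp
qed

text \<open>
  The case \<open>e = -1\<close> is the Dirichlet form of the weighted graph \<open>W\<close>; the case \<open>e = 1\<close> bounds the
  form of \<open>W\<close> from below.
\<close>

lemma sum_weighted_diff_sq:
  fixes W :: "nat \<Rightarrow> nat \<Rightarrow> real"
  assumes "symmetric N W"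
  shows "(\<Sum>i<N. \<Sum>j<N. W i j * (f i + e * f j)\<^sup>2) =
    (1 + e\<^sup>2) * (\<Sum>i<N. (\<Sum>j<N. W i j) * (f i)\<^sup>2) + 2 * e * bilin N W f f"
proof -
  have "(\<Sum>i<N. \<Sum>j<N. W i j * (f i + e * f j)\<^sup>2) =
    (\<Sum>i<N. (\<Sum>j<N. W i j) * (f i)\<^sup>2) + e\<^sup>2 * (\<Sum>i<N. \<Sum>j<N. W i j * (f j)\<^sup>2) + 2 * e * bilin N W f f"
    unfolding bilin_def
    by (simp add: power2_sum power_mult_distrib sum.distrib sum_distrib_left sum_distrib_right algebra_simps)
  also have "(\<Sum>i<N. \<Sum>j<N. W i j * (f j)\<^sup>2) = (\<Sum>j<N. \<Sum>i<N. W i j * (f j)\<^sup>2)"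
    by (rule sum.swap)
  also have "\<dots> = (\<Sum>j<N. (\<Sum>i<N. W j i) * (f j)\<^sup>2)"
    unfolding sum_distrib_right using assms
    by (intro sum.cong refl) (auto simp: symmetric_def)
  finally show ?thesis by (simp add: algebra_simps)
qed

text \<open>
  Regard \<open>W\<close> as a weighted graph and let \<open>B = \<pi>\<^sup>-\<^sup>1 W\<close> be its random walk, which is self-adjoint for
  the inner product with weights \<open>\<pi>\<close>. The hypothesis on squares says \<open>B \<le> B\<^sup>2\<close>, so every eigenvalue
  \<open>\<lambda>\<close> has \<open>\<lambda> \<le> 0\<close> or \<open>\<lambda> \<ge> 1\<close>. Every vertex of positive weight is adjacent to the vertex \<open>0\<close>, so the
  graph is connected up to vertices of weight zero; hence on functions of mean zero the eigenvalues are
  less than \<open>1\<close>, and so they are nonpositive. The proof avoids eigenvectors: a bound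
  \<open>B \<le> b < 1\<close> on functions of mean zero is improved until it reaches \<open>0\<close>.
\<close>

lemma trickle_down:
  fixes N :: nat and W :: "nat \<Rightarrow> nat \<Rightarrow> real"
  defines "\<pi> \<equiv> \<lambda>i. \<Sum>j<N. W i j"
  assumes sym: "symmetric N W"
    and nonneg: "\<And>i j. i < N \<Longrightarrow> j < N \<Longrightarrow> 0 \<le> W i j"
    and star: "\<And>i j. i < N \<Longrightarrow> j < N \<Longrightarrow> W i j > 0 \<Longrightarrow> W i 0 > 0"
    and square: "\<And>f. bilin N W f f \<le> (\<Sum>i<N. (\<Sum>j<N. W i j * f j)\<^sup>2 / \<pi> i)"
    and mean: "(\<Sum>i<N. \<pi> i * f i) = 0"
  shows "bilin N W f f \<le> 0"
proof -
  define S where "S = (\<lambda>f. \<Sum>i<N. \<pi> i * (f i)\<^sup>2)"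
  define V where "V = {f. (\<Sum>i<N. \<pi> i * f i) = 0}"
  define B where "B = (\<lambda>f i. (\<Sum>j<N. W i j * f j) / \<pi> i)"
  have pi0: "\<pi> i \<ge> 0" if "i < N" for i
    unfolding \<pi>_def using that nonneg by (intro sum_nonneg) auto
  have S0: "S g \<ge> 0" for g
    unfolding S_def using pi0 by (intro sum_nonneg) auto
  have zrow: "W i j = 0" if "i < N" "j < N" "\<pi> i = 0" for i j
    using that nonneg unfolding \<pi>_def by (subst (asm) sum_nonneg_eq_0_iff) auto
  \<comment> \<open>Division by \<open>\<pi> i = 0\<close> gives \<open>0\<close>, which is the right value because such a row of \<open>W\<close> vanishes.\<close>
  have piB: "\<pi> i * B g i = (\<Sum>j<N. W i j * g j)" if "i < N" for i g
    using zrow[OF that] unfolding B_def by (cases "\<pi> i = 0") auto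
  have bil: "bilin N W g h = (\<Sum>i<N. \<pi> i * g i * B h i)" for g h
  proof -
    have "bilin N W g h = (\<Sum>i<N. g i * (\<Sum>j<N. W i j * h j))"
      unfolding bilin_def by (simp add: sum_distrib_left mult_ac)
    also have "\<dots> = (\<Sum>i<N. g i * (\<pi> i * B h i))" using piB by simp
    finally show ?thesis by (simp add: mult_ac)
  qed
  have BV: "B g \<in> V" if "g \<in> V" for g
  proof -
    have "(\<Sum>i<N. \<pi> i * B g i) = bilin N W (\<lambda>i. 1) g" by (simp add: bil)
    also have "\<dots> = bilin N W g (\<lambda>i. 1)" by (rule bilin_commute[OF sym])
    also have "\<dots> = (\<Sum>i<N. \<pi> i * g i)"
      unfolding bilin_def \<pi>_def by (simp add: sum_distrib_right)
    finally show ?thesis using that by (simp add: V_def)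
  qed
  have linV: "(\<lambda>i. c * g i + d * h i) \<in> V" if "g \<in> V" "h \<in> V" for c d g h
  proof -
    have "(\<Sum>i<N. \<pi> i * (c * g i + d * h i)) = c * (\<Sum>i<N. \<pi> i * g i) + d * (\<Sum>i<N. \<pi> i * h i)"
      by (simp add: sum.distrib sum_distrib_left algebra_simps)
    then show ?thesis using that by (simp add: V_def)
  qed
  have SB: "bilin N W g g \<le> S (B g)" for g
  proof -
    have "(\<Sum>j<N. W i j * g j)\<^sup>2 / \<pi> i = \<pi> i * (B g i)\<^sup>2" if "i < N" for i
      unfolding B_def by (cases "\<pi> i = 0") (simp_all add: power2_eq_square)
    then show ?thesis using square[of g] by (simp add: S_def)
  qed
  have lower: "- S g \<le> bilin N W g g" for g
  proof -
    have "0 \<le> (\<Sum>i<N. \<Sum>j<N. W i j * (g i + 1 * g j)\<^sup>2)"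
      using nonneg by (intro sum_nonneg) auto
    then show ?thesis
      unfolding sum_weighted_diff_sq[OF sym] by (simp add: S_def \<pi>_def)
  qed
  \<comment> \<open>\<open>\<delta>\<close> bounds the transition probabilities to the vertex \<open>0\<close> from below; it will be a spectral gap.\<close>
  obtain \<delta> where \<delta>: "\<delta> > 0" "\<And>i. i < N \<Longrightarrow> \<delta> * \<pi> i \<le> W i 0"
  proof -
    define d where "d = (\<lambda>i. if \<pi> i = 0 then 1 else W i 0 / \<pi> i)"
    define \<delta> where "\<delta> = Min (insert 1 (d ` {..<N}))"
    have W0: "W i 0 > 0" if i: "i < N" and "\<pi> i \<noteq> 0" for i
    proof -
      obtain j where "j < N" "W i j \<noteq> 0"
        using \<open>\<pi> i \<noteq> 0\<close> unfolding \<pi>_def by (meson lessThan_iff sum.neutral)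
      then show ?thesis using star[OF i] nonneg[OF i] by fastforce
    qed
    have dpos: "d i > 0" if "i < N" for i
      using W0[OF that] pi0[OF that] by (auto simp: d_def)
    have "\<delta> > 0" unfolding \<delta>_def using dpos by (subst Min_gr_iff) auto
    moreover have "\<delta> * \<pi> i \<le> W i 0" if "i < N" for i
    proof -
      have "\<delta> \<le> d i" unfolding \<delta>_def using that by (intro Min_le) auto
      then show ?thesis using pi0[OF that] zrow[OF that, of 0] that
        by (auto simp: d_def field_simps split: if_splits)
    qed
    ultimately show thesis by (rule that)
  qed
  have gap: "bilin N W g g \<le> (1 - \<delta>) * S g" if g: "g \<in> V" for g
  proof (cases "N = 0")
    case True
    then show ?thesis by (simp add: bilin_def S_def)
  next
    case False
    \<comment> \<open>The Dirichlet form is at least its part on the edges at the vertex \<open>0\<close>, each counted twice, and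
      among constants the mean of \<open>g\<close> is the best approximation to \<open>g\<close>.\<close>
    have "2 * (\<delta> * S g) \<le> (\<Sum>i<N. \<Sum>j<N. W i j * (g i + (-1) * g j)\<^sup>2)"
    proof -
      have "S g \<le> (\<Sum>i<N. \<pi> i * (g i + (-1) * g 0)\<^sup>2)"
      proof -
        have "(\<Sum>i<N. \<pi> i * (g i + (-1) * g 0)\<^sup>2) =
            S g + (g 0)\<^sup>2 * (\<Sum>i<N. \<pi> i) - 2 * g 0 * (\<Sum>i<N. \<pi> i * g i)"
          unfolding S_def
          by (simp add: power2_diff sum.distrib sum_subtractf sum_distrib_left sum_distrib_right algebra_simps)
        moreover have "(g 0)\<^sup>2 * (\<Sum>i<N. \<pi> i) \<ge> 0"
          using pi0 by (intro mult_nonneg_nonneg sum_nonneg) auto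
        ultimately show ?thesis using g by (simp add: V_def)
      qed
      then have "\<delta> * S g \<le> (\<Sum>i<N. (\<delta> * \<pi> i) * (g i + (-1) * g 0)\<^sup>2)"
        using \<delta>(1) by (simp add: sum_distrib_left[symmetric] mult.assoc)
      also have "\<dots> \<le> (\<Sum>i<N. W i 0 * (g i + (-1) * g 0)\<^sup>2)"
        using \<delta>(2) by (intro sum_mono mult_right_mono) auto
      finally have *: "\<delta> * S g \<le> (\<Sum>i<N. W i 0 * (g i + (-1) * g 0)\<^sup>2)" .
      have row: "(\<Sum>j<N. W 0 j * (g 0 + (-1) * g j)\<^sup>2) = (\<Sum>i<N. W i 0 * (g i + (-1) * g 0)\<^sup>2)"
        using sym False by (intro sum.cong refl) (auto simp: symmetric_def power2_commute)
      have "{..<N} = insert 0 {1..<N}" using False by auto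
      then have split: "(\<Sum>i<N. F i) = F 0 + (\<Sum>i\<in>{1..<N}. F i)" for F :: "nat \<Rightarrow> real" by simp
      have "(\<Sum>i<N. W i 0 * (g i + (-1) * g 0)\<^sup>2) = (\<Sum>i\<in>{1..<N}. W i 0 * (g i + (-1) * g 0)\<^sup>2)"
        by (subst split) simp
      also have "\<dots> \<le> (\<Sum>i\<in>{1..<N}. \<Sum>j<N. W i j * (g i + (-1) * g j)\<^sup>2)"
        using False nonneg by (intro sum_mono member_le_sum) auto
      finally show ?thesis
        using * row by (subst split) linarith
    qed
    then show ?thesis
      unfolding sum_weighted_diff_sq[OF sym] by (simp add: S_def \<pi>_def algebra_simps)
  qed
  have improve: "(3 - 2 * b) * bilin N W g g \<le> b * (2 - b) * S g"
    if g: "g \<in> V" and b: "0 < b" "b < 1" and le: "\<And>h. h \<in> V \<Longrightarrow> bilin N W h h \<le> b * S h" for g b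
  proof -
    have quad: "S (\<lambda>i. c * h i + d * B h i) = c\<^sup>2 * S h + 2 * c * d * bilin N W h h + d\<^sup>2 * S (B h)"
      for c d h
      unfolding S_def bil
      by (simp add: power2_eq_square sum.distrib sum_distrib_left algebra_simps)
    \<comment> \<open>The operator \<open>C = b - B\<close> satisfies \<open>0 \<le> C \<le> 2\<close>, so \<open>\<parallel>C g\<parallel>\<^sup>2 \<le> 2 \<langle>g, C g\<rangle>\<close>. This
      is read off from positivity of \<open>C\<close> at \<open>h = g - C g / 2\<close>.\<close>
    define k where "k = (\<lambda>i. b * g i + (-1) * B g i)"
    define h where "h = (\<lambda>i. 1 * g i + (- 1/2) * k i)"
    have k: "k \<in> V" unfolding k_def using linV[OF g BV[OF g]] .
    have h: "h \<in> V" unfolding h_def using linV[OF g k] .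
    have cross: "b * (\<Sum>i<N. \<pi> i * g i * k i) - bilin N W g k = S k"
    proof -
      have "bilin N W g k = bilin N W k g" by (rule bilin_commute[OF sym])
      also have "\<dots> = (\<Sum>i<N. \<pi> i * k i * B g i)" by (rule bil)
      finally have "bilin N W g k = (\<Sum>i<N. \<pi> i * k i * B g i)" .
      moreover have "S k = (\<Sum>i<N. \<pi> i * k i * (b * g i - B g i))"
        unfolding S_def k_def by (simp add: power2_eq_square mult_ac)
      ultimately show ?thesis
        by (simp add: sum_distrib_left sum_subtractf algebra_simps)
    qed
    have Sh: "S h = S g - (\<Sum>i<N. \<pi> i * g i * k i) + S k / 4"
      unfolding S_def h_def
      by (simp add: power2_eq_square sum.distrib sum_distrib_left sum_subtractf
          sum_divide_distrib algebra_simps add_divide_distrib)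
    have Bh: "bilin N W h h = bilin N W g g - bilin N W g k + bilin N W k k / 4"
      unfolding h_def bilin_quadratic[OF sym] by (simp add: power2_eq_square)
    have "0 \<le> b * S h - bilin N W h h" using le[OF h] by simp
    also have "\<dots> = b * S g - bilin N W g g - S k + (b * S k - bilin N W k k) / 4"
      unfolding Sh Bh using cross by (simp add: field_simps)
    also have "\<dots> \<le> b * S g - bilin N W g g - S k + (S k + S k) / 4"
    proof -
      have "b * S k \<le> S k" using b S0[of k] by (simp add: mult_left_le_one_le)
      then have "(b * S k - bilin N W k k) / 4 \<le> (S k + S k) / 4"
        using lower[of k] by (intro divide_right_mono) auto
      then show ?thesis by linarith
    qed
    finally have "S k \<le> 2 * (b * S g - bilin N W g g)" by simp
    moreover have "S k = b\<^sup>2 * S g - 2 * b * bilin N W g g + S (B g)"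
      unfolding k_def quad by simp
    ultimately show ?thesis using SB[of g] by (simp add: power2_eq_square algebra_simps)
  qed
  have "f \<in> V" using mean by (simp add: V_def)
  moreover have "1 - \<delta> < 1" using \<delta>(1) by simp
  ultimately show ?thesis
    using contraction_nonpos[of V S "\<lambda>g. bilin N W g g" "1 - \<delta>" f] S0 gap improve by blast
qed


section \<open>Directional derivatives of normalized coefficients\<close>

definition unit_exp :: "nat \<Rightarrow> monomial" where
  "unit_exp i = Poly_Mapping.single i 1"

lemma lookup_unit_exp: "Poly_Mapping.lookup (unit_exp i) j = of_bool (i = j)"
  by (simp add: unit_exp_def lookup_single when_def)

text \<open>
  If \<open>g\<close> gives the normalized coefficients of a polynomial, this gives those of its derivative in the
  direction \<open>v\<close>: normalization absorbs the factors of differentiation.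
\<close>

definition dirderiv :: "nat \<Rightarrow> (nat \<Rightarrow> real) \<Rightarrow> (monomial \<Rightarrow> real) \<Rightarrow> monomial \<Rightarrow> real" where
  "dirderiv N v g m = (\<Sum>j<N. v j * g (m + unit_exp j))"

text \<open>
  The partial derivative with respect to \<open>w\<^sub>i\<close>, in terms of normalized coefficients.
\<close>

definition shift :: "nat \<Rightarrow> (monomial \<Rightarrow> real) \<Rightarrow> monomial \<Rightarrow> real" where
  "shift i g m = g (m + unit_exp i)"

text \<open>
  Only the coefficients of degree two enter.
\<close>

definition hessian :: "(monomial \<Rightarrow> real) \<Rightarrow> nat \<Rightarrow> nat \<Rightarrow> real" where
  "hessian g i j = g (unit_exp i + unit_exp j)"

text \<open>
  The support is closed under replacing a variable by \<open>w\<^sub>0\<close>. In degree two this makes every index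
  with a nonzero row a neighbour of \<open>0\<close>, which is the connectedness needed for \<open>trickle_down\<close>; and
  unlike connectedness it is inherited by derivatives.
\<close>

definition star_positive :: "nat \<Rightarrow> (monomial \<Rightarrow> real) \<Rightarrow> bool" where
  "star_positive N g \<longleftrightarrow> (\<forall>m. 0 \<le> g m) \<and>
     (\<forall>m. \<forall>j<N. g (m + unit_exp j) > 0 \<longrightarrow> g (m + unit_exp 0) > 0)"

lemma dirderiv_commute: "dirderiv N v (dirderiv N w g) = dirderiv N w (dirderiv N v g)"
proof
  fix m
  have "dirderiv N v (dirderiv N w g) m = (\<Sum>i<N. \<Sum>j<N. v i * w j * g (m + unit_exp i + unit_exp j))"
    by (simp add: dirderiv_def sum_distrib_left mult_ac)
  also have "\<dots> = (\<Sum>j<N. \<Sum>i<N. v i * w j * g (m + unit_exp i + unit_exp j))"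
    by (rule sum.swap)
  also have "\<dots> = dirderiv N w (dirderiv N v g) m"
    by (simp add: dirderiv_def sum_distrib_left mult_ac add_ac)
  finally show "dirderiv N v (dirderiv N w g) m = dirderiv N w (dirderiv N v g) m" .
qed

lemma shift_dirderiv: "shift i (dirderiv N v g) = dirderiv N v (shift i g)"
  by (auto simp: shift_def dirderiv_def add_ac)

lemma symmetric_hessian: "symmetric N (hessian g)"
  by (simp add: symmetric_def hessian_def add.commute)

lemma star_positive_shift:
  assumes "star_positive N g"
  shows "star_positive N (shift i g)"
  unfolding star_positive_def shift_def
proof (intro conjI allI impI)
  show "0 \<le> g (m + unit_exp i)" for m
    using assms by (simp add: star_positive_def)
  fix m j assume j: "j < N" and pos: "0 < g (m + unit_exp j + unit_exp i)"
  from pos have "0 < g ((m + unit_exp i) + unit_exp j)" by (simp add: add_ac)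
  then have "0 < g ((m + unit_exp i) + unit_exp 0)"
    using assms j unfolding star_positive_def by blast
  then show "0 < g (m + unit_exp 0 + unit_exp i)" by (simp add: add_ac)
qed

lemma star_positive_dirderiv:
  assumes g: "star_positive N g" and v: "\<And>j. j < N \<Longrightarrow> v j \<ge> 0"
  shows "star_positive N (dirderiv N v g)"
  unfolding star_positive_def
proof (intro conjI allI impI)
  have nn: "0 \<le> v j * g m" if "j < N" for j m
    using g v that by (simp add: star_positive_def)
  show "0 \<le> dirderiv N v g m" for m
    unfolding dirderiv_def using nn by (intro sum_nonneg) auto
  fix m j assume j: "j < N" and pos: "0 < dirderiv N v g (m + unit_exp j)"
  obtain k where k: "k < N" "v k * g (m + unit_exp j + unit_exp k) > 0"
  proof (rule ccontr)
    assume "\<not> thesis"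
    then have "dirderiv N v g (m + unit_exp j) \<le> 0"
      unfolding dirderiv_def using that by (intro sum_nonpos) force
    with pos show False by simp
  qed
  have vk: "v k > 0" using k v[of k] by (simp add: zero_less_mult_iff)
  then have "g ((m + unit_exp k) + unit_exp j) > 0"
    using k by (simp add: zero_less_mult_iff add_ac)
  then have "g ((m + unit_exp k) + unit_exp 0) > 0"
    using g j unfolding star_positive_def by blast
  then have "0 < v k * g (m + unit_exp 0 + unit_exp k)"
    using vk by (simp add: add_ac)
  also have "\<dots> \<le> dirderiv N v g (m + unit_exp 0)"
    unfolding dirderiv_def using k nn by (intro member_le_sum) auto
  finally show "0 < dirderiv N v g (m + unit_exp 0)" .
qed


section \<open>From coordinate directions to positive directions\<close>

text \<open>
  The polynomial with normalized coefficients \<open>g\<close> is thought of as cubic, that is, as a symmetric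
  trilinear form. Fixing one argument to be \<open>e\<^sub>i\<close> gives \<open>G i\<close>, fixing it to be \<open>a\<close> gives \<open>H\<close>.
\<close>

locale trilinear =
  fixes N :: nat and g :: "monomial \<Rightarrow> real" and a :: "nat \<Rightarrow> real"
  assumes star: "star_positive N g"
    and hyp: "\<And>i. i < N \<Longrightarrow> hyperbolic N (hessian (shift i g))"
    and a: "\<And>i. i < N \<Longrightarrow> a i > 0"
begin

abbreviation "H \<equiv> hessian (dirderiv N a g)"
abbreviation "G i \<equiv> hessian (shift i g)"

lemma G_nonneg: "0 \<le> G i j k"
  using star by (simp add: hessian_def shift_def star_positive_def)

lemma star_positive_D: "star_positive N (dirderiv N a g)"
  by (rule star_positive_dirderiv[OF star]) (use a in \<open>auto intro: less_imp_le\<close>)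

lemma H_nonneg: "0 \<le> H i j"
  using star_positive_D by (simp add: hessian_def star_positive_def)

lemma H_star: "j < N \<Longrightarrow> 0 < H i j \<Longrightarrow> 0 < H i 0"
  using star_positive_D unfolding hessian_def star_positive_def by blast

lemma H_eq: "H j k = (\<Sum>i<N. a i * G i j k)"
  by (simp add: hessian_def shift_def dirderiv_def add_ac)

lemma bilin_H: "bilin N H x y = (\<Sum>i<N. a i * bilin N (G i) x y)"
proof -
  have "bilin N H x y = (\<Sum>j<N. \<Sum>k<N. \<Sum>i<N. a i * (G i j k * x j * y k))"
    unfolding bilin_def H_eq by (simp add: sum_distrib_left sum_distrib_right mult_ac)
  also have "\<dots> = (\<Sum>j<N. \<Sum>i<N. \<Sum>k<N. a i * (G i j k * x j * y k))"
    by (intro sum.cong refl sum.swap)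
  also have "\<dots> = (\<Sum>i<N. \<Sum>j<N. \<Sum>k<N. a i * (G i j k * x j * y k))"
    by (rule sum.swap)
  finally show ?thesis by (simp add: bilin_def sum_distrib_left)
qed

lemma row_H: "(\<Sum>j<N. H i j * x j) = bilin N (G i) x a"
proof -
  have *: "G k i j = G i j k" for j k
    by (simp add: hessian_def shift_def add_ac)
  show ?thesis
    unfolding H_eq bilin_def by (simp add: * sum_distrib_left sum_distrib_right mult_ac)
qed

text \<open>
  Reverse Cauchy-Schwarz. If \<open>G i\<close> vanishes at \<open>a\<close>, then it is zero since its entries are nonnegative,
  and both sides are \<open>0\<close>.
\<close>

lemma G_le:
  assumes i: "i < N"
  shows "bilin N (G i) x x \<le> (bilin N (G i) x a)\<^sup>2 / bilin N (G i) a a"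
proof (cases "bilin N (G i) a a > 0")
  case True
  then show ?thesis
    using reverse_cauchy_schwarz[OF symmetric_hessian hyp[OF i] True, of x] by (simp add: field_simps)
next
  case False
  then have "bilin N (G i) x x = 0"
    using bilin_zero_if_positive_zero[of N "G i" a x x] G_nonneg a by auto
  moreover have "bilin N (G i) a a = 0"
    using False bilin_zero_if_positive_zero[of N "G i" a a a] G_nonneg a by auto
  ultimately show ?thesis by simp
qed

text \<open>
  The sum of the inequalities \<open>G_le\<close> with weights \<open>a\<^sub>i\<close> is the hypothesis of \<open>trickle_down\<close> for
  \<open>W\<^sub>i\<^sub>j = a\<^sub>i H\<^sub>i\<^sub>j a\<^sub>j\<close> and \<open>f\<^sub>i = x\<^sub>i / a\<^sub>i\<close>, whose sum with weights \<open>\<pi>\<close> is \<open>H(x, a)\<close>.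
\<close>

lemma H_complement_nonpos:
  assumes xa: "bilin N H x a = 0"
  shows "bilin N H x x \<le> 0"
proof -
  define W where "W = (\<lambda>i j. a i * H i j * a j)"
  have bilW: "bilin N W f f = bilin N H (\<lambda>i. a i * f i) (\<lambda>i. a i * f i)" for f
    unfolding bilin_def W_def by (simp add: mult_ac)
  have rowW: "(\<Sum>j<N. W i j * f j) = a i * bilin N (G i) (\<lambda>j. a j * f j) a" for i f
    unfolding row_H[symmetric] W_def by (simp add: sum_distrib_left mult_ac)
  have piW: "(\<Sum>j<N. W i j) = a i * bilin N (G i) a a" for i
    using rowW[of i "\<lambda>_. 1"] by simp
  define f where "f = (\<lambda>i. x i / a i)"
  have af: "a i * f i = x i" if "i < N" for i using a[OF that] by (simp add: f_def)
  have "bilin N W f f \<le> 0"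
  proof (rule trickle_down)
    show "symmetric N W"
      using symmetric_hessian[of N "dirderiv N a g"] by (simp add: symmetric_def W_def)
    show "0 \<le> W i j" if "i < N" "j < N" for i j
      using a[OF that(1)] a[OF that(2)] H_nonneg by (simp add: W_def)
    show "0 < W i 0" if ij: "i < N" "j < N" "0 < W i j" for i j
    proof -
      have "0 < H i j" using ij a[of i] a[of j] by (simp add: W_def zero_less_mult_iff)
      then have "0 < H i 0" using H_star ij by blast
      then show ?thesis using a[of i] a[of 0] ij by (simp add: W_def)
    qed
    show "bilin N W f f \<le> (\<Sum>i<N. (\<Sum>j<N. W i j * f j)\<^sup>2 / (\<Sum>j<N. W i j))" for f
    proof -
      let ?x = "\<lambda>i. a i * f i"
      have "bilin N W f f = (\<Sum>i<N. a i * bilin N (G i) ?x ?x)" unfolding bilW bilin_H ..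
      also have "\<dots> \<le> (\<Sum>i<N. a i * ((bilin N (G i) ?x a)\<^sup>2 / bilin N (G i) a a))"
        using a by (intro sum_mono mult_left_mono G_le) (auto simp: less_imp_le)
      also have "\<dots> = (\<Sum>i<N. (\<Sum>j<N. W i j * f j)\<^sup>2 / (\<Sum>j<N. W i j))"
        unfolding rowW piW using a
        by (intro sum.cong refl) (auto simp: power2_eq_square)
      finally show ?thesis .
    qed
    have "W i j * f i = H i j * x i * a j" if "i < N" for i j
    proof -
      have "W i j * f i = H i j * (a i * f i) * a j" by (simp add: W_def)
      then show ?thesis by (simp only: af[OF that])
    qed
    then have "(\<Sum>i<N. (\<Sum>j<N. W i j) * f i) = bilin N H x a"
      unfolding bilin_def sum_distrib_right by (intro sum.cong refl) auto
    also have "\<dots> = 0" by (rule xa)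
    finally show "(\<Sum>i<N. (\<Sum>j<N. W i j) * f i) = 0" .
  qed
  also have "bilin N W f f = bilin N H x x"
    unfolding bilW by (rule bilin_cong) (auto simp: af)
  finally show ?thesis .
qed

lemma hyperbolic_H: "hyperbolic N H"
proof (cases "bilin N H a a > 0")
  case True
  then show ?thesis
    using H_complement_nonpos by (intro hyperbolic_if_complement_nonpos[OF symmetric_hessian])
next
  case False
  then have "bilin N H x y = 0" for x y
    using H_nonneg a by (intro bilin_zero_if_positive_zero[where a = a]) auto
  then show ?thesis by (simp add: hyperbolic_def)
qed

text \<open>
  If \<open>H(x, x) = 0\<close> on the complement of \<open>a\<close>, then \<open>x\<close> lies in the kernel of \<open>H\<close>, so \<open>G i\<close> vanishes
  at \<open>(x, a)\<close> for every \<open>i\<close>. Then all \<open>G i\<close> are nonpositive at \<open>(x, x)\<close>, and a positive combination of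
  them is zero, so \<open>G 0\<close> vanishes there as well.
\<close>

lemma strictly_hyperbolic_H:
  assumes strict: "strictly_hyperbolic N (G 0)" and N: "0 < N"
  shows "strictly_hyperbolic N H"
proof (cases "bilin N H a a > 0")
  case Haa: True
  have G0aa: "bilin N (G 0) a a > 0"
  proof (rule ccontr)
    assume "\<not> ?thesis"
    then have "bilin N (G 0) x y = 0" for x y
      using G_nonneg a by (intro bilin_zero_if_positive_zero[where a = a]) auto
    then have "(\<Sum>j<N. H 0 j * a j) = 0" unfolding row_H .
    then have row0: "(\<Sum>j<N. H 0 j * a j) = 0" by simp
    have H0: "H 0 j = 0" if "j < N" for j
    proof -
      have "0 \<le> H 0 j * a j" if "j < N" for j
        using a[OF that] H_nonneg[of 0 j] by simp
      then have "H 0 j * a j \<le> (\<Sum>j<N. H 0 j * a j)"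
        using that by (intro member_le_sum) auto
      then have "H 0 j * a j \<le> 0" by (simp only: row0)
      then show ?thesis using a[OF that] H_nonneg[of 0 j] by (simp add: mult_le_0_iff)
    qed
    have "H i j = 0" if "i < N" "j < N" for i j
    proof (rule ccontr)
      assume "H i j \<noteq> 0"
      then have "0 < H j i" using H_nonneg[of j i] by (simp add: hessian_def add.commute)
      then have "0 < H j 0" using H_star that by blast
      then show False using H0[of j] that by (simp add: hessian_def add.commute)
    qed
    then have "bilin N H a a = 0" by (simp add: bilin_def)
    with Haa show False by simp
  qed
  show ?thesis
  proof (rule strictly_hyperbolic_if_complement_neg[OF symmetric_hessian Haa])
    fix x assume xa: "bilin N H x a = 0" and x: "\<exists>i<N. x i \<noteq> 0"
    show "bilin N H x x < 0"
    proof (rule ccontr)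
      assume "\<not> ?thesis"
      then have xx: "bilin N H x x = 0" using H_complement_nonpos[OF xa] by simp
      \<comment> \<open>An isotropic vector of a semidefinite form is orthogonal to everything: otherwise
        \<open>H(s x + y, s x + y) = 2 s H(x, y) + H(y, y)\<close> would be positive for some \<open>s\<close>.\<close>
      have orth: "bilin N H x y = 0" if ya: "bilin N H y a = 0" for y
      proof -
        define c where "c = bilin N H x y"
        define d where "d = bilin N H y y"
        have d: "d \<le> 0" unfolding d_def by (rule H_complement_nonpos[OF ya])
        have q: "2 * s * c + d \<le> 0" for s
        proof -
          have "bilin N H (\<lambda>i. s * x i + 1 * y i) a = 0"
            by (simp only: bilin_lin_left xa ya)
          from H_complement_nonpos[OF this] show ?thesis
            by (simp only: bilin_quadratic[OF symmetric_hessian] xx c_def d_def) simp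
        qed
        have "c = 0"
        proof (rule ccontr)
          assume "c \<noteq> 0"
          then show False using q[of "(1 - d) / (2 * c)"] by (simp add: field_simps)
        qed
        then show ?thesis by (simp add: c_def)
      qed
      have kernel: "bilin N H x y = 0" for y
      proof -
        let ?z = "\<lambda>i. bilin N H a a * y i + (- bilin N H y a) * a i"
        have "bilin N H ?z a = 0" by (simp only: bilin_lin_left) simp
        then have "bilin N H x ?z = 0" by (rule orth)
        then show ?thesis using Haa by (simp only: bilin_lin_right xa) simp
      qed
      have Gxa: "bilin N (G i) x a = 0" if "i < N" for i
      proof -
        have "bilin N (G i) x a = (\<Sum>j<N. H i j * x j)" by (simp add: row_H)
        also have "\<dots> = (\<Sum>j<N. \<Sum>k<N. if k = i then H j k * x j else 0)"
          using that by (simp add: hessian_def add.commute)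
        also have "\<dots> = bilin N H x (\<lambda>k. if k = i then 1 else 0)"
          unfolding bilin_def by (intro sum.cong refl) auto
        finally show ?thesis using kernel by simp
      qed
      have "bilin N (G i) x x \<le> 0" if "i < N" for i
        using G_le[OF that, of x] Gxa[OF that] by simp
      then have nn: "a i * bilin N (G i) x x \<le> 0" if "i < N" for i
        using that a[OF that] by (simp add: mult_le_0_iff)
      have "bilin N (G 0) x x < 0"
        using strict G0aa Gxa[OF N] x unfolding strictly_hyperbolic_def by blast
      then have "a 0 * bilin N (G 0) x x < 0" using a[OF N] by (simp add: mult_less_0_iff)
      then have "(\<Sum>i<N. a i * bilin N (G i) x x) < (\<Sum>i<N. 0)"
        using nn N by (intro sum_strict_mono_ex1) auto
      then show False using xx by (simp add: bilin_H)
    qed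
  qed
next
  case False
  then have "bilin N H x y = 0" for x y
    using H_nonneg a by (intro bilin_zero_if_positive_zero[where a = a]) auto
  then show ?thesis by (simp add: strictly_hyperbolic_def)
qed

end

text \<open>
  Taking the derivatives one at a time matches the induction by which coordinate directions are
  exchanged for positive ones.
\<close>

fun coord_hyperbolic :: "nat \<Rightarrow> nat \<Rightarrow> (monomial \<Rightarrow> real) \<Rightarrow> bool" where
  "coord_hyperbolic N 0 g = hyperbolic N (hessian g)"
| "coord_hyperbolic N (Suc k) g = (\<forall>i<N. coord_hyperbolic N k (shift i g))"

fun strictly_hyperbolic_at_0 :: "nat \<Rightarrow> nat \<Rightarrow> (monomial \<Rightarrow> real) \<Rightarrow> bool" where
  "strictly_hyperbolic_at_0 N 0 g = strictly_hyperbolic N (hessian g)"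
| "strictly_hyperbolic_at_0 N (Suc k) g = strictly_hyperbolic_at_0 N k (shift 0 g)"

text \<open>
  Directional and coordinate derivatives commute, so all but the last coordinate derivative can be
  taken first; what remains is the cubic case.
\<close>

lemma coord_hyperbolic_dirderiv:
  assumes "star_positive N g" "coord_hyperbolic N (Suc k) g" and a: "\<And>i. i < N \<Longrightarrow> a i > 0"
  shows "coord_hyperbolic N k (dirderiv N a g)"
  using assms(1,2)
proof (induction k arbitrary: g)
  case 0
  then interpret trilinear N g a by unfold_locales (auto simp: a)
  show ?case using hyperbolic_H by simp
next
  case (Suc k)
  then show ?case by (auto simp: shift_dirderiv star_positive_shift)
qed

lemma strictly_hyperbolic_at_0_dirderiv:
  assumes "star_positive N g" "coord_hyperbolic N (Suc k) g" "strictly_hyperbolic_at_0 N (Suc k) g"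
    and a: "\<And>i. i < N \<Longrightarrow> a i > 0" and N: "0 < N"
  shows "strictly_hyperbolic_at_0 N k (dirderiv N a g)"
  using assms(1-3)
proof (induction k arbitrary: g)
  case 0
  then interpret trilinear N g a by unfold_locales (auto simp: a)
  show ?case using strictly_hyperbolic_H N 0 by simp
next
  case (Suc k)
  then show ?case using N by (auto simp: shift_dirderiv star_positive_shift)
qed

lemma strictly_hyperbolic_iterated_dirderiv:
  assumes "star_positive N g" "coord_hyperbolic N (length as) g"
    and "strictly_hyperbolic_at_0 N (length as) g"
    and "\<And>a i. a \<in> set as \<Longrightarrow> i < N \<Longrightarrow> a i > 0" and "0 < N"
  shows "strictly_hyperbolic N (hessian (fold (dirderiv N) as g))"
  using assms
proof (induction as arbitrary: g)
  case (Cons a as)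
  have "star_positive N (dirderiv N a g)"
    using Cons.prems by (intro star_positive_dirderiv) (auto simp: less_imp_le)
  moreover have "coord_hyperbolic N (length as) (dirderiv N a g)"
    using Cons.prems by (intro coord_hyperbolic_dirderiv) auto
  moreover have "strictly_hyperbolic_at_0 N (length as) (dirderiv N a g)"
    using Cons.prems by (intro strictly_hyperbolic_at_0_dirderiv) auto
  ultimately show ?case using Cons.prems by (simp add: Cons.IH)
qed simp

lemma coord_hyperbolicI:
  assumes "\<And>m. hyperbolic N (\<lambda>i j. g (m + unit_exp i + unit_exp j))"
  shows "coord_hyperbolic N k g"
  using assms
proof (induction k arbitrary: g)
  case 0
  then show ?case using "0"[of 0] by (simp add: hessian_def [abs_def])
next
  case (Suc k)
  have "hyperbolic N (\<lambda>i j. shift l g (m + unit_exp i + unit_exp j))" for l m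
    using Suc.prems[of "m + unit_exp l"] by (simp add: shift_def add_ac)
  then show ?case using Suc.IH by simp
qed

lemma strictly_hyperbolic_at_0I:
  assumes "strictly_hyperbolic N (\<lambda>i j. g (Poly_Mapping.single 0 k + unit_exp i + unit_exp j))"
  shows "strictly_hyperbolic_at_0 N k g"
  using assms
proof (induction k arbitrary: g)
  case 0
  then show ?case by (simp add: hessian_def [abs_def])
next
  case (Suc k)
  have "Poly_Mapping.single 0 (Suc k) = Poly_Mapping.single 0 k + unit_exp 0"
    by (simp add: unit_exp_def flip: single_add)
  with Suc show ?case by (simp add: shift_def add_ac)
qed


section \<open>Signature of a nondegenerate form\<close>

text \<open>
  Filling up the coefficient matrix of the \<open>k\<close> equations with zero rows gives a singular square
  matrix.
\<close>

lemma underdetermined_orthogonal: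
  assumes k: "k < N"
  shows "\<exists>x. (\<exists>i<N. x i \<noteq> 0) \<and> (\<forall>i<k. bilin N Q (v i) x = 0)"
proof -
  define M where "M = mat N N (\<lambda>(i, l). if i < k then \<Sum>m<N. Q m l * v i m else 0)"
  have M: "M \<in> carrier_mat N N" by (simp add: M_def)
  have "M = mat\<^sub>r N N (\<lambda>i. if i = k then 0\<^sub>v N else row M i)"
    using k by (intro eq_matI) (auto simp: M_def)
  also have "det \<dots> = 0"
    using k M by (intro det_row_0) auto
  finally have "det M = 0" .
  then obtain w where w: "w \<in> carrier_vec N" "w \<noteq> 0\<^sub>v N" "M *\<^sub>v w = 0\<^sub>v N"
    using det_0_iff_vec_prod_zero[OF M] by blast
  define x where "x = (\<lambda>i. w $ i)"
  have "\<exists>i<N. x i \<noteq> 0"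
  proof (rule ccontr)
    assume "\<not> ?thesis"
    then have "w = 0\<^sub>v N" using w(1) by (intro eq_vecI) (auto simp: x_def)
    with w(2) show False by simp
  qed
  moreover have "bilin N Q (v i) x = 0" if i: "i < k" for i
  proof -
    have "0 = (M *\<^sub>v w) $ i" using w(3) i k by simp
    also have "\<dots> = (\<Sum>l<N. (\<Sum>m<N. Q m l * v i m) * x l)"
      using i k w(1) by (simp add: M_def scalar_prod_def x_def lessThan_atLeast0)
    also have "\<dots> = (\<Sum>l<N. \<Sum>m<N. Q m l * v i m * x l)"
      by (simp add: sum_distrib_right)
    also have "\<dots> = bilin N Q (v i) x"
      unfolding bilin_def by (rule sum.swap)
    finally show ?thesis by simp
  qed
  ultimately show ?thesis by blast
qed

text \<open>
  Gram-Schmidt orthogonalization, started at the positive vector: by strict hyperbolicity all later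
  vectors are negative and can be normalized.
\<close>

lemma lorentzian_basis:
  assumes sym: "symmetric N Q" and sh: "strictly_hyperbolic N Q" and a: "bilin N Q a a > 0"
    and "k < N"
  shows "\<exists>v. \<forall>i\<le>k. \<forall>j\<le>k. bilin N Q (v i) (v j) = (if i = j then if i = 0 then 1 else -1 else 0)"
  using assms(4)
proof (induction k)
  case 0
  let ?v = "\<lambda>_::nat. \<lambda>i. (1 / sqrt (bilin N Q a a)) * a i"
  have "bilin N Q (?v 0) (?v 0) = 1"
    unfolding bilin_scale using a by (simp add: real_div_sqrt divide_simps)
  then show ?case by (intro exI[of _ ?v]) auto
next
  case (Suc k)
  then obtain v where v: "\<And>i j. i \<le> k \<Longrightarrow> j \<le> k \<Longrightarrow>
      bilin N Q (v i) (v j) = (if i = j then if i = 0 then 1 else -1 else 0)"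
    by auto
  obtain x where x: "\<exists>i<N. x i \<noteq> 0" "\<And>i. i \<le> k \<Longrightarrow> bilin N Q (v i) x = 0"
    using underdetermined_orthogonal[OF Suc.prems, of Q v] by (auto simp: less_Suc_eq_le)
  have x': "bilin N Q x (v i) = 0" if "i \<le> k" for i
    using x(2)[OF that] by (simp add: bilin_commute[OF sym, of x])
  have neg: "bilin N Q x x < 0"
  proof -
    have "bilin N Q (v 0) (v 0) > 0" using v[of 0 0] by simp
    then show ?thesis
      using sh x(1) x'[of 0] unfolding strictly_hyperbolic_def by blast
  qed
  define c where "c = 1 / sqrt (- bilin N Q x x)"
  have c: "c * (c * bilin N Q x x) = -1"
    using neg by (simp add: c_def field_simps)
  define v' where "v' = v(Suc k := \<lambda>i. c * x i)"
  have "bilin N Q (v' i) (v' j) = (if i = j then if i = 0 then 1 else -1 else 0)"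
    if "i \<le> Suc k" "j \<le> Suc k" for i j
    using that v x' x(2) c by (auto simp: v'_def bilin_scale le_Suc_eq)
  then show ?case by blast
qed

lemma has_signature_if_strictly_hyperbolic:
  assumes gram: "gram_mat N q = mat N N (\<lambda>(i, j). Q i j)"
    and sym: "symmetric N Q" and sh: "strictly_hyperbolic N Q" and a: "bilin N Q a a > 0"
  shows "has_signature N q 1 (N - 1)"
proof -
  have N: "N > 0" using a by (cases N) (auto simp: bilin_def)
  let ?d = "\<lambda>i::nat. if i = 0 then 1 else -1 :: real"
  obtain v where v': "\<forall>i\<le>N - 1. \<forall>j\<le>N - 1. bilin N Q (v i) (v j) = (if i = j then ?d i else 0)"
    using lorentzian_basis[OF sym sh a, of "N - 1"] N by auto
  have v: "bilin N Q (v i) (v j) = (if i = j then ?d i else 0)" if "i < N" "j < N" for i j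
    using v' that by (metis Suc_pred' N less_Suc_eq_le)
  define P where "P = mat N N (\<lambda>(i, j). v j i)"
  define G where "G = gram_mat N q"
  have P: "P \<in> carrier_mat N N" by (simp add: P_def)
  have G: "G \<in> carrier_mat N N" by (simp add: G_def gram)
  have PGP: "transpose_mat P * G * P = mat_diag N ?d"
  proof (rule eq_matI)
    fix i j assume ij: "i < dim_row (mat_diag N ?d)" "j < dim_col (mat_diag N ?d)"
    then have ij': "i < N" "j < N" by (auto simp: mat_diag_def)
    have "(transpose_mat P * G * P) $$ (i, j) = (\<Sum>l<N. (\<Sum>m<N. v i m * Q m l) * v j l)"
      using ij' by (simp add: P_def G_def gram scalar_prod_def lessThan_atLeast0)
    also have "\<dots> = (\<Sum>l<N. \<Sum>m<N. Q m l * v i m * v j l)"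
      by (simp add: sum_distrib_left sum_distrib_right mult_ac)
    also have "\<dots> = bilin N Q (v i) (v j)"
      unfolding bilin_def by (rule sum.swap)
    also have "\<dots> = mat_diag N ?d $$ (i, j)"
      using v[OF ij'] ij' by (auto simp: mat_diag_def)
    finally show "(transpose_mat P * G * P) $$ (i, j) = mat_diag N ?d $$ (i, j)" .
  qed (use P G in \<open>auto simp: mat_diag_def\<close>)
  \<comment> \<open>The diagonal matrix is its own inverse, so it provides a left inverse of \<open>P\<close>.\<close>
  let ?R = "mat_diag N ?d * (transpose_mat P * G)"
  have R: "?R \<in> carrier_mat N N"
    using P G by (intro mult_carrier_mat[of _ N N _ N]) auto
  have "?R * P = mat_diag N ?d * (transpose_mat P * G * P)"
    using P G by (intro assoc_mult_mat[of _ N N _ N _ N]) auto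
  also have "\<dots> = mat_diag N (\<lambda>i. ?d i * ?d i)" by (simp only: PGP mat_diag_diag)
  also have "(\<lambda>i. ?d i * ?d i) = (\<lambda>_. 1)" by auto
  finally have RP: "?R * P = 1\<^sub>m N" by simp
  have "P * ?R = 1\<^sub>m N" by (rule mat_mult_left_right_inverse[OF R P RP])
  then have "invertible_mat P"
    using RP P R unfolding invertible_mat_def inverts_mat_def
    by (intro conjI exI[of _ ?R]) auto
  moreover have "mat_diag N ?d = mat_diag N (\<lambda>i. if i < 1 then 1 else if i < 1 + (N - 1) then -1 else 0)"
    by (auto simp: mat_diag_def)
  ultimately show ?thesis
    unfolding has_signature_def using P PGP N by (auto simp: G_def)
qed


section \<open>Parallel elements and a correlation inequality for matroid quotients\<close>

lemma sum_sq_le_sum_of_sq: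
  fixes f :: "'a \<Rightarrow> real"
  shows "(\<Sum>i\<in>I. f i)\<^sup>2 \<le> (\<Sum>i\<in>I. (f i)\<^sup>2) * card I"
proof -
  have "0 \<le> (\<Sum>i\<in>I. \<Sum>j\<in>I. (f i - f j)\<^sup>2)"
    by (intro sum_nonneg) auto
  also have "\<dots> = 2 * ((\<Sum>i\<in>I. (f i)\<^sup>2) * card I) - 2 * (\<Sum>i\<in>I. f i)\<^sup>2"
    by (simp add: sum.distrib sum_subtractf power2_eq_square sum_product
        sum_distrib_left algebra_simps)
  finally show ?thesis by simp
qed


lemma (in matroid) rk_insert_le:
  assumes "T \<subseteq> E" "i \<in> E"
  shows "rk (insert i T) \<le> rk T + 1"
proof -
  have "rk (T \<union> {i}) + rk (T \<inter> {i}) \<le> rk T + rk {i}"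
    using assms by (intro rk_submodular) auto
  moreover have "rk {i} \<le> 1" using rk_le_card[of "{i}"] assms by simp
  ultimately show ?thesis by simp
qed

lemma (in matroid) rk_insert_ge:
  assumes "T \<subseteq> E" "i \<in> E"
  shows "rk T \<le> rk (insert i T)"
  using assms by (intro rk_mono) auto

lemma (in matroid) rk_insert_insert_le:
  assumes "T \<subseteq> E" "i \<in> E" "j \<in> E"
  shows "rk (insert i (insert j T)) + rk T \<le> rk (insert i T) + rk (insert j T)"
proof -
  have "rk (insert i T \<union> insert j T) + rk (insert i T \<inter> insert j T) \<le> rk (insert i T) + rk (insert j T)"
    using assms by (intro rk_submodular) auto
  moreover have "rk T \<le> rk (insert i T \<inter> insert j T)"
    using assms by (intro rk_mono) auto
  ultimately show ?thesis by (simp add: insert_commute)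
qed

lemma matroid_pullback:
  assumes "matroid F rk" "finite E" "f ` E \<subseteq> F"
  shows "matroid E (\<lambda>S. rk (f ` S))"
proof -
  interpret matroid F rk by fact
  show ?thesis
  proof
    fix S assume S: "S \<subseteq> E"
    have "rk (f ` S) \<le> card (f ` S)" using S assms(3) by (intro rk_le_card) auto
    also have "\<dots> \<le> card S" using S assms(2) finite_subset by (intro card_image_le) blast
    finally show "rk (f ` S) \<le> card S" .
  next
    fix S T assume "S \<subseteq> T" "T \<subseteq> E"
    then show "rk (f ` S) \<le> rk (f ` T)" using assms(3) by (intro rk_mono) auto
  next
    fix S T assume ST: "S \<subseteq> E" "T \<subseteq> E"
    have "rk (f ` (S \<union> T)) + rk (f ` (S \<inter> T)) \<le> rk (f ` S \<union> f ` T) + rk (f ` S \<inter> f ` T)"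
      unfolding image_Un using ST assms(3) by (intro add_left_mono rk_mono) auto
    also have "\<dots> \<le> rk (f ` S) + rk (f ` T)"
      using ST assms(3) by (intro rk_submodular) auto
    finally show "rk (f ` (S \<union> T)) + rk (f ` (S \<inter> T)) \<le> rk (f ` S) + rk (f ` T)" .
  qed fact
qed

text \<open>
  In the contraction by \<open>T\<close>, both elements are nonloops and together they have rank one. The case
  \<open>i = j\<close> is included: an element is parallel to itself if and only if it is a nonloop.
\<close>

definition parallel :: "('a set \<Rightarrow> nat) \<Rightarrow> 'a set \<Rightarrow> 'a \<Rightarrow> 'a \<Rightarrow> bool" where
  "parallel rk T i j \<longleftrightarrow> rk (insert i T) = rk T + 1 \<and> rk (insert j T) = rk T + 1 \<and>
     rk (insert i (insert j T)) = rk T + 1"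

lemma parallel_sym: "parallel rk T i j \<Longrightarrow> parallel rk T j i"
  by (auto simp: parallel_def insert_commute)

text \<open>
  If both elements are nonloops, then together they raise the rank by one or by two, and parallel means
  one. Otherwise one of them is a loop, and adding it changes no rank.
\<close>

lemma (in matroid) rk_insert_insert:
  assumes "T \<subseteq> E" "i \<in> E" "j \<in> E"
  shows "rk (insert i T) + rk (insert j T) =
    rk (insert i (insert j T)) + rk T + (if parallel rk T i j then 1 else 0)"
proof -
  have Tj: "insert j T \<subseteq> E" and Ti: "insert i T \<subseteq> E" using assms by auto
  note facts = rk_insert_le[OF assms(1,2)] rk_insert_le[OF assms(1,3)]
    rk_insert_ge[OF assms(1,2)] rk_insert_ge[OF assms(1,3)]
    rk_insert_ge[OF Tj assms(2)] rk_insert_ge[OF Ti assms(3)] rk_insert_insert_le[OF assms]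
  then show ?thesis by (auto simp: parallel_def insert_commute)
qed

lemma (in matroid) parallel_trans:
  assumes "T \<subseteq> E" "i \<in> E" "j \<in> E" "k \<in> E" and ij: "parallel rk T i j" and jk: "parallel rk T j k"
  shows "parallel rk T i k"
proof -
  have "rk (insert i (insert k (insert j T))) + rk (insert j T) \<le>
      rk (insert i (insert j T)) + rk (insert k (insert j T))"
    using assms(1-4) by (intro rk_insert_insert_le) auto
  moreover have "rk (insert i (insert k T)) \<le> rk (insert i (insert k (insert j T)))"
    using assms(1-4) by (intro rk_mono) auto
  moreover have "rk (insert i T) \<le> rk (insert i (insert k T))"
    using assms(1-4) by (intro rk_mono) auto
  ultimately show ?thesis
    using ij jk by (auto simp: parallel_def insert_commute)
qed

text \<open>
  The double sum is the sum of \<open>(\<Sum>\<^bsub>i \<in> C\<^esub> z\<^sub>i)\<^sup>2\<close> over the fibres \<open>C\<close> of \<open>g\<close>, and there are at most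
  \<open>|R|\<close> nonempty fibres.
\<close>

lemma sum_sq_le_card_mult_fibres:
  fixes z :: "'a \<Rightarrow> real"
  assumes R: "finite R"
  shows "(\<Sum>i\<in>R. z i)\<^sup>2 \<le> card R * (\<Sum>i\<in>R. \<Sum>j\<in>R. if g i = g j then z i * z j else 0)"
proof -
  define s where "s = (\<lambda>y. \<Sum>i\<in>{i. i \<in> R \<and> g i = y}. z i)"
  have fib: "(\<Sum>y\<in>g ` R. \<Sum>i\<in>{i. i \<in> R \<and> g i = y}. h i) = (\<Sum>i\<in>R. h i)" for h :: "'a \<Rightarrow> real"
    using R by (intro sum.group) auto
  have "(\<Sum>i\<in>R. z i)\<^sup>2 = (\<Sum>y\<in>g ` R. s y)\<^sup>2" unfolding s_def fib ..
  also have "\<dots> \<le> (\<Sum>y\<in>g ` R. (s y)\<^sup>2) * card (g ` R)"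
    by (rule sum_sq_le_sum_of_sq)
  also have "\<dots> \<le> (\<Sum>y\<in>g ` R. (s y)\<^sup>2) * card R"
    using card_image_le[OF R, of g] by (intro mult_left_mono sum_nonneg) auto
  also have "(\<Sum>y\<in>g ` R. (s y)\<^sup>2) = (\<Sum>y\<in>g ` R. \<Sum>i\<in>{i. i \<in> R \<and> g i = y}. z i * s (g i))"
  proof (rule sum.cong[OF refl])
    fix y
    have "(s y)\<^sup>2 = (\<Sum>i\<in>{i. i \<in> R \<and> g i = y}. z i * s y)"
      by (simp add: power2_eq_square s_def sum_distrib_right)
    then show "(s y)\<^sup>2 = (\<Sum>i\<in>{i. i \<in> R \<and> g i = y}. z i * s (g i))" by simp
  qed
  also have "\<dots> = (\<Sum>i\<in>R. z i * s (g i))" by (rule fib)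
  also have "\<dots> = (\<Sum>i\<in>R. \<Sum>j\<in>R. if g i = g j then z i * z j else 0)"
  proof (rule sum.cong[OF refl])
    fix i
    have "s (g i) = (\<Sum>j\<in>R. if g i = g j then z j else 0)"
      unfolding s_def using R by (subst sum.inter_filter) (auto intro!: sum.cong)
    then show "z i * s (g i) = (\<Sum>j\<in>R. if g i = g j then z i * z j else 0)"
      by (simp add: sum_distrib_left if_distrib cong: if_cong)
  qed
  finally show ?thesis by (simp add: mult.commute)
qed

lemma sum_sq_le_card_mult_equivalence:
  fixes z :: "'a \<Rightarrow> real"
  assumes R: "finite R" and refl: "\<And>i. i \<in> R \<Longrightarrow> P i i"
    and sym: "\<And>i j. i \<in> R \<Longrightarrow> j \<in> R \<Longrightarrow> P i j \<Longrightarrow> P j i"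
    and trans: "\<And>i j k. i \<in> R \<Longrightarrow> j \<in> R \<Longrightarrow> k \<in> R \<Longrightarrow> P i j \<Longrightarrow> P j k \<Longrightarrow> P i k"
  shows "(\<Sum>i\<in>R. z i)\<^sup>2 \<le> card R * (\<Sum>i\<in>R. \<Sum>j\<in>R. of_bool (P i j) * (z i * z j))"
proof -
  define g where "g = (\<lambda>i. {j \<in> R. P i j})"
  have "g i = g j \<longleftrightarrow> P i j" if "i \<in> R" "j \<in> R" for i j
    using refl[OF that(1)] refl[OF that(2)] that sym trans unfolding g_def by blast
  then have "(\<Sum>i\<in>R. \<Sum>j\<in>R. if g i = g j then z i * z j else 0) =
      (\<Sum>i\<in>R. \<Sum>j\<in>R. of_bool (P i j) * (z i * z j))"
    by (intro sum.cong refl) auto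
  then show ?thesis using sum_sq_le_card_mult_fibres[OF R, of z g] by simp
qed

text \<open>
  Pulling \<open>N\<close> back along a morphism \<open>f : M \<rightarrow> N\<close> to the ground set of \<open>M\<close> gives two rank functions on
  the same set, and the condition on morphisms says that the second matroid is a quotient of the
  first.
\<close>

locale matroid_quotient = M: matroid E r1 + N: matroid E r2
  for E :: "'a set" and r1 r2 :: "'a set \<Rightarrow> nat" +
  fixes p q :: real
  assumes quotient: "S \<subseteq> S' \<Longrightarrow> S' \<subseteq> E \<Longrightarrow> r2 S' + r1 S \<le> r1 S' + r2 S"
    and p: "0 < p" "p \<le> 1" and q: "0 < q" "q \<le> 1"
begin

definition weight :: "'a set \<Rightarrow> real" where
  "weight S = p powi (- int (r1 S)) * q powi (- int (r2 S))"

text \<open>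
  The ratio \<open>c(T) c(Tij) / (c(Ti) c(Tj))\<close> of the weights \<open>c\<close>, see \<open>weight_exchange\<close>.
\<close>

definition \<rho> :: "'a set \<Rightarrow> 'a \<Rightarrow> 'a \<Rightarrow> real" where
  "\<rho> T i j = (if parallel r1 T i j then p else 1) * (if parallel r2 T i j then q else 1)"

lemma weight_pos: "weight S > 0"
  using p q by (simp add: weight_def)

lemma \<rho>_pos: "\<rho> T i j > 0"
  using p q by (simp add: \<rho>_def)

lemma weight_exchange:
  assumes "T \<subseteq> E" "i \<in> E" "j \<in> E"
  shows "weight T * weight (insert i (insert j T)) =
    \<rho> T i j * weight (insert i T) * weight (insert j T)"
proof -
  have w: "weight S = 1 / (p ^ r1 S * q ^ r2 S)" for S
    by (simp add: weight_def power_int_minus field_simps)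
  have M: "p ^ r1 (insert i T) * p ^ r1 (insert j T) =
      p ^ r1 (insert i (insert j T)) * p ^ r1 T * (if parallel r1 T i j then p else 1)"
    using M.rk_insert_insert[OF assms] by (simp flip: power_add)
  have N: "q ^ r2 (insert i T) * q ^ r2 (insert j T) =
      q ^ r2 (insert i (insert j T)) * q ^ r2 T * (if parallel r2 T i j then q else 1)"
    using N.rk_insert_insert[OF assms] by (simp flip: power_add)
  have "weight (insert i T) * weight (insert j T) =
      1 / ((p ^ r1 (insert i T) * p ^ r1 (insert j T)) * (q ^ r2 (insert i T) * q ^ r2 (insert j T)))"
    by (simp add: w)
  also have "\<dots> = weight T * weight (insert i (insert j T)) / \<rho> T i j"
    unfolding M N by (simp add: w \<rho>_def)
  finally show ?thesis using \<rho>_pos[of T i j] by (simp add: field_simps)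
qed

lemma parallel_quotient:
  assumes "T \<subseteq> E" "i \<in> E" "j \<in> E" "parallel r1 T i j" "r2 (insert j T) = r2 T + 1"
  shows "parallel r2 T i j"
proof -
  have "r2 (insert i (insert j T)) + r1 (insert j T) \<le> r1 (insert i (insert j T)) + r2 (insert j T)"
    using assms by (intro quotient) auto
  moreover have "r2 (insert i (insert j T)) + r1 (insert i T) \<le> r1 (insert i (insert j T)) + r2 (insert i T)"
    using assms by (intro quotient) auto
  moreover have "r2 (insert j T) \<le> r2 (insert i (insert j T))"
    using assms by (intro N.rk_mono) auto
  moreover have "r2 (insert i T) \<le> r2 T + 1" using assms by (intro N.rk_insert_le) auto
  ultimately show ?thesis
    using assms(4,5) by (simp add: parallel_def)
qed

text \<open>
  Keep the relation of being parallel in the first matroid with probability \<open>1 - p\<close> and, independently,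
  that in the second one with probability \<open>1 - q\<close>. For \<open>i \<noteq> j\<close> the number \<open>1 - \<rho> T i j\<close> is the
  probability that a kept relation holds between \<open>i\<close> and \<open>j\<close>. Each of the four outcomes is, together
  with equality, an equivalence relation, so \<open>sum_sq_le_card_mult_equivalence\<close> applies to it. The
  outcome of probability \<open>p q\<close> where nothing is kept is evaluated exactly, which gives room for a
  strict inequality.
\<close>

lemma sum_sq_le_correlation:
  fixes z :: "'a \<Rightarrow> real"
  assumes T: "T \<subseteq> E" and R: "R \<subseteq> E"
  shows "(1 - p * q) * (\<Sum>i\<in>R. z i)\<^sup>2 + p * q * card R * (\<Sum>i\<in>R. (z i)\<^sup>2) \<le>
    card R * (\<Sum>i\<in>R. \<Sum>j\<in>R. (if i = j then 1 else 1 - \<rho> T i j) * (z i * z j))"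
proof -
  have fR: "finite R" using R M.finite_ground finite_subset by blast
  let ?M = "\<lambda>i j. i = j \<or> parallel r1 T i j"
  let ?N = "\<lambda>i j. i = j \<or> parallel r2 T i j"
  let ?MN = "\<lambda>i j. i = j \<or> parallel r1 T i j \<or> parallel r2 T i j"
  define X where "X = (\<lambda>P. \<Sum>i\<in>R. \<Sum>j\<in>R. of_bool (P i j) * (z i * z j))"
  define F where "F = (\<lambda>P. card R * X P)"
  have inE: "i \<in> E" if "i \<in> R" for i using that R by auto
  have 1: "(\<Sum>i\<in>R. z i)\<^sup>2 \<le> F ?M" unfolding F_def X_def
  proof (rule sum_sq_le_card_mult_equivalence[OF fR])
    show "?M i k" if "i \<in> R" "j \<in> R" "k \<in> R" "?M i j" "?M j k" for i j k
      using that M.parallel_trans[OF T, of i j k] inE by auto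
    show "?M j i" if "?M i j" for i j
      using that parallel_sym[of r1 T i j] by auto
  qed auto
  have 2: "(\<Sum>i\<in>R. z i)\<^sup>2 \<le> F ?N" unfolding F_def X_def
  proof (rule sum_sq_le_card_mult_equivalence[OF fR])
    show "?N i k" if "i \<in> R" "j \<in> R" "k \<in> R" "?N i j" "?N j k" for i j k
      using that N.parallel_trans[OF T, of i j k] inE by auto
    show "?N j i" if "?N i j" for i j
      using that parallel_sym[of r2 T i j] by auto
  qed auto
  \<comment> \<open>This step needs the quotient condition: without it the union of the two relations could fail to be
    transitive.\<close>
  have mixed: "parallel r2 T i k"
    if "i \<in> R" "j \<in> R" "k \<in> R" "parallel r1 T i j" "parallel r2 T j k" for i j k
  proof -
    have "parallel r2 T i j"
      using that inE T by (intro parallel_quotient) (auto simp: parallel_def)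
    then show ?thesis using that N.parallel_trans[OF T, of i j k] inE by auto
  qed
  have 3: "(\<Sum>i\<in>R. z i)\<^sup>2 \<le> F ?MN" unfolding F_def X_def
  proof (rule sum_sq_le_card_mult_equivalence[OF fR])
    show "?MN i k" if "i \<in> R" "j \<in> R" "k \<in> R" "?MN i j" "?MN j k" for i j k
      using that mixed[of i j k] mixed[of k j i] M.parallel_trans[OF T, of i j k]
        N.parallel_trans[OF T, of i j k] inE parallel_sym[of r1 T j k] parallel_sym[of r2 T i j]
        parallel_sym[of r2 T k i]
      by auto
    show "?MN j i" if "?MN i j" for i j
      using that parallel_sym[of _ T i j] by blast
  qed auto
  have 4: "F (=) = card R * (\<Sum>i\<in>R. (z i)\<^sup>2)"
  proof -
    have "(\<Sum>j\<in>R. of_bool (i = j) * (z i * z j)) = (z i)\<^sup>2" if "i \<in> R" for i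
      using fR that by (subst sum.remove[of R i]) (auto simp: power2_eq_square intro!: sum.neutral)
    then show ?thesis by (simp add: F_def X_def)
  qed
  have conv: "(if i = j then 1 else 1 - \<rho> T i j) =
     (1 - p) * (1 - q) * of_bool (?MN i j) + (1 - p) * q * of_bool (?M i j) +
     p * (1 - q) * of_bool (?N i j) + p * q * of_bool (i = j)" for i j
    by (auto simp: \<rho>_def algebra_simps)
  have "(1 - p * q) * (\<Sum>i\<in>R. z i)\<^sup>2 = (1 - p) * (1 - q) * (\<Sum>i\<in>R. z i)\<^sup>2 +
      (1 - p) * q * (\<Sum>i\<in>R. z i)\<^sup>2 + p * (1 - q) * (\<Sum>i\<in>R. z i)\<^sup>2"
    by (simp add: algebra_simps)
  also have "\<dots> \<le> (1 - p) * (1 - q) * F ?MN + (1 - p) * q * F ?M + p * (1 - q) * F ?N"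
    using p q 1 2 3 by (intro add_mono mult_left_mono) auto
  finally have "(1 - p * q) * (\<Sum>i\<in>R. z i)\<^sup>2 + p * q * F (=) \<le>
      (1 - p) * (1 - q) * F ?MN + (1 - p) * q * F ?M + p * (1 - q) * F ?N + p * q * F (=)"
    by simp
  also have "\<dots> = card R * (\<Sum>i\<in>R. \<Sum>j\<in>R. (if i = j then 1 else 1 - \<rho> T i j) * (z i * z j))"
  proof -
    have K: "(\<Sum>i\<in>R. \<Sum>j\<in>R. (if i = j then 1 else 1 - \<rho> T i j) * (z i * z j)) =
      (1 - p) * ((1 - q) * X ?MN) + (1 - p) * (q * X ?M) + p * ((1 - q) * X ?N) + p * (q * X (=))"
      unfolding conv X_def
      by (simp only: distrib_right sum.distrib mult.assoc sum_distrib_left[symmetric])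
    show ?thesis unfolding K F_def by (simp add: algebra_simps)
  qed
  finally show ?thesis by (simp add: 4 mult_ac)
qed

lemma pair_sum_eq:
  fixes z :: "'a \<Rightarrow> real"
  assumes "finite R"
  shows "(\<Sum>i\<in>R. \<Sum>j\<in>R - {i}. \<rho> T i j * (z i * z j)) = (\<Sum>i\<in>R. z i)\<^sup>2 -
    (\<Sum>i\<in>R. \<Sum>j\<in>R. (if i = j then 1 else 1 - \<rho> T i j) * (z i * z j))"
proof -
  have "(\<Sum>i\<in>R. z i)\<^sup>2 = (\<Sum>i\<in>R. \<Sum>j\<in>R. z i * z j)"
    by (simp add: power2_eq_square sum_product)
  moreover have "(\<Sum>j\<in>R - {i}. \<rho> T i j * (z i * z j)) =
      (\<Sum>j\<in>R. z i * z j - (if i = j then 1 else 1 - \<rho> T i j) * (z i * z j))" if "i \<in> R" for i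
    unfolding sum.remove[OF assms that, of "\<lambda>j. z i * z j - (if i = j then 1 else 1 - \<rho> T i j) * (z i * z j)"]
    by (simp, rule sum.cong[OF refl], auto simp: algebra_simps)
  ultimately show ?thesis by (simp add: sum_subtractf)
qed

text \<open>
  The factor \<open>s\<close> prepares for the damped coefficient of \<open>w\<^sub>0\<^sup>n\<close>. Since the right-hand side is
  nonnegative, the case \<open>s = 1\<close> implies the others.
\<close>

lemma pair_sum_le:
  fixes z :: "'a \<Rightarrow> real"
  assumes T: "T \<subseteq> E" and R: "R \<subseteq> E" and s: "0 \<le> s" "s \<le> 1" and R1: "1 \<le> card R"
  shows "card R * (s * (\<Sum>i\<in>R. \<Sum>j\<in>R - {i}. \<rho> T i j * (z i * z j))) \<le> (real (card R) - 1) * (\<Sum>i\<in>R. z i)\<^sup>2"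
proof -
  have fR: "finite R" using R M.finite_ground finite_subset by blast
  have pq: "0 \<le> p * q" using p q by simp
  have "p * q * (\<Sum>i\<in>R. z i)\<^sup>2 \<le> p * q * (card R * (\<Sum>i\<in>R. (z i)\<^sup>2))"
    using sum_sq_le_sum_of_sq[of z R] pq by (intro mult_left_mono) (auto simp: mult.commute)
  with sum_sq_le_correlation[OF T R, of z]
  have "card R * (\<Sum>i\<in>R. \<Sum>j\<in>R - {i}. \<rho> T i j * (z i * z j)) \<le> (real (card R) - 1) * (\<Sum>i\<in>R. z i)\<^sup>2"
    unfolding pair_sum_eq[OF fR] using R1 by (simp add: of_nat_diff algebra_simps)
  then have "s * (card R * (\<Sum>i\<in>R. \<Sum>j\<in>R - {i}. \<rho> T i j * (z i * z j))) \<le>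
      s * ((real (card R) - 1) * (\<Sum>i\<in>R. z i)\<^sup>2)"
    using s by (intro mult_left_mono) auto
  also have "\<dots> \<le> 1 * ((real (card R) - 1) * (\<Sum>i\<in>R. z i)\<^sup>2)"
    using s R1 by (intro mult_right_mono) auto
  finally show ?thesis by (simp add: mult_ac)
qed

text \<open>
  If \<open>\<Sum> z\<^sub>i \<noteq> 0\<close>, the factor \<open>s\<close> makes the inequality strict; otherwise the term
  \<open>p q |R| \<Sum> z\<^sub>i\<^sup>2\<close> of \<open>sum_sq_le_correlation\<close> does.
\<close>

lemma pair_sum_less:
  fixes z :: "'a \<Rightarrow> real"
  assumes T: "T \<subseteq> E" and R: "R \<subseteq> E" and s: "0 < s" "s < 1" and R2: "2 \<le> card R"
    and z: "\<exists>i\<in>R. z i \<noteq> 0"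
  shows "card R * (s * (\<Sum>i\<in>R. \<Sum>j\<in>R - {i}. \<rho> T i j * (z i * z j))) < (real (card R) - 1) * (\<Sum>i\<in>R. z i)\<^sup>2"
proof (cases "(\<Sum>i\<in>R. z i) = 0")
  case False
  let ?X = "(\<Sum>i\<in>R. \<Sum>j\<in>R - {i}. \<rho> T i j * (z i * z j))"
  have "card R * (1 * ?X) \<le> (real (card R) - 1) * (\<Sum>i\<in>R. z i)\<^sup>2"
    using R2 by (intro pair_sum_le[OF T R]) auto
  then have "s * (card R * ?X) \<le> s * ((real (card R) - 1) * (\<Sum>i\<in>R. z i)\<^sup>2)"
    using s by (intro mult_left_mono) auto
  also have "\<dots> < 1 * ((real (card R) - 1) * (\<Sum>i\<in>R. z i)\<^sup>2)"
    using s R2 False by (intro mult_strict_right_mono mult_pos_pos) auto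
  finally show ?thesis by (simp add: mult_ac)
next
  case True
  have fR: "finite R" using R M.finite_ground finite_subset by blast
  have "0 < (\<Sum>i\<in>R. (z i)\<^sup>2)"
  proof -
    obtain i where "i \<in> R" "z i \<noteq> 0" using z by blast
    then show ?thesis using fR by (intro sum_pos2[of R i]) auto
  qed
  then have "0 < p * q * card R * (\<Sum>i\<in>R. (z i)\<^sup>2)"
    using p q R2 by simp
  also have "\<dots> \<le> card R * (\<Sum>i\<in>R. \<Sum>j\<in>R. (if i = j then 1 else 1 - \<rho> T i j) * (z i * z j))"
    using sum_sq_le_correlation[OF T R, of z] True by simp
  finally have "card R * (\<Sum>i\<in>R. \<Sum>j\<in>R - {i}. \<rho> T i j * (z i * z j)) < 0"
    unfolding pair_sum_eq[OF fR] using True by (simp add: mult_less_0_iff)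
  then have "s * (card R * (\<Sum>i\<in>R. \<Sum>j\<in>R - {i}. \<rho> T i j * (z i * z j))) < 0"
    using s by (simp add: mult_less_0_iff)
  then show ?thesis using True by (simp add: mult_ac)
qed

end


section \<open>Quadratic derivatives of the partition function\<close>

text \<open>
  The index \<open>0\<close> is left out because only \<open>w\<^sub>1, \<dots>, w\<^sub>n\<close> correspond to elements of the matroid.
\<close>

definition supp :: "monomial \<Rightarrow> nat set" where
  "supp m = Poly_Mapping.keys m - {0}"

text \<open>
  The monomials of degree \<open>d\<close> that are a power of \<open>w\<^sub>0\<close> times distinct variables among
  \<open>w\<^sub>1, \<dots>, w\<^sub>n\<close>.
\<close>

definition squarefree_part :: "nat \<Rightarrow> nat \<Rightarrow> monomial \<Rightarrow> bool" where
  "squarefree_part n d m \<longleftrightarrow> supp m \<subseteq> {1..n} \<and> (\<forall>i\<in>supp m. Poly_Mapping.lookup m i = 1) \<and>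
     Poly_Mapping.lookup m 0 + card (supp m) = d"

lemma supp_add_0: "supp (m + unit_exp 0) = supp m"
  by (auto simp: supp_def in_keys_iff lookup_add lookup_unit_exp)

lemma supp_add: "j \<noteq> 0 \<Longrightarrow> supp (m + unit_exp j) = insert j (supp m)"
  by (auto simp: supp_def in_keys_iff lookup_add lookup_unit_exp)

lemma squarefree_part_add_0:
  "squarefree_part n (Suc d) (m + unit_exp 0) \<longleftrightarrow> squarefree_part n d m"
proof -
  have "Poly_Mapping.lookup (m + unit_exp 0) i = Poly_Mapping.lookup m i" if "i \<in> supp m" for i
    using that by (auto simp: supp_def lookup_add lookup_unit_exp)
  then show ?thesis
    unfolding squarefree_part_def supp_add_0 by (auto simp: lookup_add lookup_unit_exp)
qed

lemma squarefree_part_add: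
  assumes j: "j \<in> {1..n}"
  shows "squarefree_part n (Suc d) (m + unit_exp j) \<longleftrightarrow> squarefree_part n d m \<and> j \<notin> supp m"
proof -
  have fin: "finite (supp m)" by (simp add: supp_def)
  have j0: "j \<noteq> 0" using j by auto
  have l: "Poly_Mapping.lookup (m + unit_exp j) i = Poly_Mapping.lookup m i + of_bool (i = j)" for i
    by (auto simp: lookup_add lookup_unit_exp)
  show ?thesis
  proof (cases "j \<in> supp m")
    case True
    then have "Poly_Mapping.lookup m j \<noteq> 0" by (simp add: supp_def in_keys_iff)
    then have "\<not> squarefree_part n (Suc d) (m + unit_exp j)"
      unfolding squarefree_part_def supp_add[OF j0] l by auto
    with True show ?thesis by simp
  next
    case False
    then have "Poly_Mapping.lookup m j = 0" using j0 by (simp add: supp_def in_keys_iff)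
    then show ?thesis
      using False fin j j0 unfolding squarefree_part_def supp_add[OF j0] l by auto
  qed
qed

locale quotient_on_interval = matroid_quotient "{1..n}" r1 r2 p q for n :: nat and r1 r2 p q
begin

text \<open>
  The set \<open>{}\<close> belongs to the monomial \<open>w\<^sub>0\<^sup>n\<close>. Changing its coefficient alone makes the
  quadratic form \<open>\<partial>\<^sub>0\<^sup>n\<^sup>-\<^sup>2 Z\<close> nondegenerate.
\<close>

definition damping :: "real \<Rightarrow> nat set \<Rightarrow> real" where
  "damping s S = (if S = {} then s else 1)"

text \<open>
  The coefficients of \<open>Z\<close>, with that of \<open>w\<^sub>0\<^sup>n\<close> multiplied by \<open>s\<close>, times the factorial of the
  exponent vector, which is the factorial of the exponent of \<open>w\<^sub>0\<close> alone.
\<close>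

definition normalized_coeff :: "real \<Rightarrow> monomial \<Rightarrow> real" where
  "normalized_coeff s m = (if squarefree_part n n m
     then fact (Poly_Mapping.lookup m 0) * (damping s (supp m) * weight (supp m)) else 0)"

lemma damping_pos: "s > 0 \<Longrightarrow> damping s S > 0"
  by (simp add: damping_def)

lemma normalized_coeff_pos_iff: "s > 0 \<Longrightarrow> normalized_coeff s m > 0 \<longleftrightarrow> squarefree_part n n m"
  by (simp add: normalized_coeff_def damping_pos weight_pos)

lemma star_positive_normalized_coeff:
  assumes s: "s > 0"
  shows "star_positive (Suc n) (normalized_coeff s)"
  unfolding star_positive_def
proof (intro conjI allI impI)
  show "0 \<le> normalized_coeff s m" for m
    using damping_pos[OF s, of "supp m"] weight_pos[of "supp m"] by (simp add: normalized_coeff_def)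
  fix m j assume j: "j < Suc n" and pos: "0 < normalized_coeff s (m + unit_exp j)"
  show "0 < normalized_coeff s (m + unit_exp 0)"
  proof (cases "j = 0")
    case False
    then obtain d where d: "n = Suc d" using j by (cases n) auto
    have "squarefree_part n n (m + unit_exp j)" using pos by (simp only: normalized_coeff_pos_iff[OF s])
    then have "squarefree_part n (Suc d) (m + unit_exp j)" by (simp only: d[symmetric])
    then have "squarefree_part n d m"
      using False j squarefree_part_add[of j n d m] by simp
    then have "squarefree_part n (Suc d) (m + unit_exp 0)" by (simp only: squarefree_part_add_0)
    then have "squarefree_part n n (m + unit_exp 0)" by (simp only: d[symmetric])
    then show ?thesis by (simp only: normalized_coeff_pos_iff[OF s])
  qed (use pos in simp)
qed

text \<open>
  \<open>Q\<close> is the Hessian of the derivative of \<open>Z\<close> (damped by \<open>s\<close>) with respect to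
  \<open>\<mu> = w\<^sub>0\<^sup>k \<Prod>\<^bsub>i \<in> T\<^esub> w\<^sub>i\<close>. Its nonzero rows are those of \<open>0\<close> and of the elements of \<open>R\<close>.
\<close>

context
  fixes s :: real and k :: nat and \<mu> :: monomial and T R Q
  assumes s: "0 < s" "s \<le> 1" and \<mu>: "squarefree_part n (n - 2) \<mu>" and n: "n \<ge> 2"
  defines "k \<equiv> Poly_Mapping.lookup \<mu> 0" and "T \<equiv> supp \<mu>" and "R \<equiv> {1..n} - T"
    and "Q \<equiv> \<lambda>i j. normalized_coeff s (\<mu> + unit_exp i + unit_exp j)"
begin

lemma T_subset: "T \<subseteq> {1..n}"
  using \<mu> by (simp add: squarefree_part_def T_def)

lemma card_R: "card R = k + 2"
proof -
  have "finite T" using T_subset finite_subset by blast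
  then have "card R = n - card T" using T_subset by (simp add: R_def card_Diff_subset)
  moreover have "k + card T = n - 2" using \<mu> by (simp add: squarefree_part_def T_def k_def)
  ultimately show ?thesis using n by simp
qed

lemma symmetric_Q: "symmetric (Suc n) Q"
  by (simp add: symmetric_def Q_def add_ac)

lemma n_eq: "n = Suc (Suc (n - 2))"
  using n by simp

lemma Q_00: "Q 0 0 = fact (k + 2) * (damping s T * weight T)"
proof -
  have "squarefree_part n n (\<mu> + unit_exp 0 + unit_exp 0)"
    by (subst (2) n_eq) (simp only: squarefree_part_add_0 \<mu>)
  then show ?thesis
    by (simp add: Q_def normalized_coeff_def supp_add_0 T_def[symmetric] lookup_add lookup_unit_exp k_def)
qed

lemma Q_0i:
  assumes "i \<in> {1..n}"
  shows "Q 0 i = (if i \<in> R then fact (k + 1) * weight (insert i T) else 0)"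
proof -
  have "squarefree_part n n (\<mu> + unit_exp 0 + unit_exp i) \<longleftrightarrow> i \<in> R"
    using assms \<mu> by (subst (2) n_eq)
      (simp add: squarefree_part_add squarefree_part_add_0 supp_add_0 R_def T_def)
  then show ?thesis
    using assms by (simp add: Q_def normalized_coeff_def supp_add_0 supp_add T_def[symmetric] lookup_add
        lookup_unit_exp k_def damping_def)
qed

lemma Q_ij:
  assumes "i \<in> {1..n}" "j \<in> {1..n}"
  shows "Q i j = (if i \<in> R \<and> j \<in> R \<and> i \<noteq> j then fact k * weight (insert i (insert j T)) else 0)"
proof -
  have "squarefree_part n n (\<mu> + unit_exp i + unit_exp j) \<longleftrightarrow> i \<in> R \<and> j \<in> R \<and> i \<noteq> j"
    using assms \<mu> by (subst (2) n_eq)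
      (auto simp: squarefree_part_add supp_add R_def T_def)
  then show ?thesis
    using assms by (simp add: Q_def normalized_coeff_def supp_add T_def[symmetric] lookup_add
        lookup_unit_exp k_def damping_def insert_commute)
qed

text \<open>
  After the rescaling \<open>z\<close> of the variables, the exchange relation for the weights turns the Schur
  complement of \<open>Q\<^sub>0\<^sub>0\<close> into a positive multiple of the difference of the two sides of \<open>pair_sum_le\<close>.
\<close>

lemma discriminant:
  fixes x :: "nat \<Rightarrow> real"
  defines "z \<equiv> \<lambda>i. weight (insert i T) * x i"
  shows "Q 0 0 * (\<Sum>i\<in>{1..n}. \<Sum>j\<in>{1..n}. Q i j * x i * x j) - (\<Sum>i\<in>{1..n}. Q 0 i * x i)\<^sup>2 =
    fact k * fact (k + 1) * (card R * (damping s T * (\<Sum>i\<in>R. \<Sum>j\<in>R - {i}. \<rho> T i j * (z i * z j))) -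
      (real (card R) - 1) * (\<Sum>i\<in>R. z i)\<^sup>2)"
proof -
  have fR: "finite R" "R \<subseteq> {1..n}" by (auto simp: R_def)
  have L: "(\<Sum>i\<in>{1..n}. Q 0 i * x i) = fact (k + 1) * (\<Sum>i\<in>R. z i)"
  proof -
    have "(\<Sum>i\<in>{1..n}. Q 0 i * x i) = (\<Sum>i\<in>R. Q 0 i * x i)"
      using fR Q_0i by (intro sum.mono_neutral_right) auto
    also have "\<dots> = (\<Sum>i\<in>R. fact (k + 1) * z i)"
      using fR Q_0i by (intro sum.cong refl) (auto simp: z_def)
    finally show ?thesis by (simp add: sum_distrib_left)
  qed
  have S: "weight T * (\<Sum>i\<in>{1..n}. \<Sum>j\<in>{1..n}. Q i j * x i * x j) =
      fact k * (\<Sum>i\<in>R. \<Sum>j\<in>R - {i}. \<rho> T i j * (z i * z j))"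
  proof -
    have inner: "(\<Sum>j\<in>{1..n}. Q i j * x i * x j) = (\<Sum>j\<in>R - {i}. Q i j * x i * x j)" if "i \<in> {1..n}" for i
      using fR that Q_ij[OF that] by (intro sum.mono_neutral_right) auto
    have outer: "(\<Sum>j\<in>R - {i}. Q i j * x i * x j) = 0" if "i \<in> {1..n} - R" for i
      using fR that Q_ij by (intro sum.neutral) auto
    have "(\<Sum>i\<in>{1..n}. \<Sum>j\<in>{1..n}. Q i j * x i * x j) = (\<Sum>i\<in>{1..n}. \<Sum>j\<in>R - {i}. Q i j * x i * x j)"
      by (rule sum.cong[OF refl inner])
    also have "\<dots> = (\<Sum>i\<in>R. \<Sum>j\<in>R - {i}. Q i j * x i * x j)"
      using fR outer by (intro sum.mono_neutral_right) auto
    finally have "weight T * (\<Sum>i\<in>{1..n}. \<Sum>j\<in>{1..n}. Q i j * x i * x j) =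
      (\<Sum>i\<in>R. \<Sum>j\<in>R - {i}. weight T * (Q i j * x i * x j))"
      by (simp add: sum_distrib_left)
    also have "\<dots> = (\<Sum>i\<in>R. \<Sum>j\<in>R - {i}. fact k * (\<rho> T i j * (z i * z j)))"
    proof (intro sum.cong refl)
      fix i j assume ij: "i \<in> R" "j \<in> R - {i}"
      have ij': "i \<in> {1..n}" "j \<in> {1..n}" using ij fR by blast+
      have Qij: "Q i j = fact k * weight (insert i (insert j T))"
        using ij unfolding Q_ij[OF ij'] by auto
      have "weight T * weight (insert i (insert j T)) =
          \<rho> T i j * weight (insert i T) * weight (insert j T)"
        using ij fR by (intro weight_exchange T_subset) auto
      then have "fact k * (weight T * weight (insert i (insert j T))) * x i * x j =
          fact k * (\<rho> T i j * weight (insert i T) * weight (insert j T)) * x i * x j"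
        by simp
      then show "weight T * (Q i j * x i * x j) = fact k * (\<rho> T i j * (z i * z j))"
        unfolding Qij z_def by (simp add: mult_ac)
    qed
    finally show ?thesis by (simp add: sum_distrib_left)
  qed
  let ?P = "\<Sum>i\<in>R. \<Sum>j\<in>R - {i}. \<rho> T i j * (z i * z j)"
  have "Q 0 0 * (\<Sum>i\<in>{1..n}. \<Sum>j\<in>{1..n}. Q i j * x i * x j) =
      fact (k + 2) * damping s T * (fact k * ?P)"
    unfolding Q_00 S[symmetric] by (simp add: mult_ac)
  moreover have "fact (k + 2) = real (k + 2) * fact (k + 1)" "fact (k + 1) = real (k + 1) * fact k"
    by simp_all
  ultimately show ?thesis
    unfolding L card_R by (simp add: power2_eq_square algebra_simps)
qed

lemma Q_00_pos: "Q 0 0 > 0"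
  unfolding Q_00 using damping_pos[OF s(1)] weight_pos by simp

lemma hyperbolic_Q: "hyperbolic (Suc n) Q"
proof (rule hyperbolic_if_complement_nonpos[OF symmetric_Q, of "\<lambda>i. of_bool (i = 0)"])
  fix x assume x: "bilin (Suc n) Q x (\<lambda>i. of_bool (i = 0)) = 0"
  have "Q 0 0 * bilin (Suc n) Q x x \<le> 0"
    unfolding bilin_complete_square(1)[OF symmetric_Q x] discriminant
    using pair_sum_le[of T R "damping s T" "\<lambda>i. weight (insert i T) * x i"] T_subset card_R s
    by (intro mult_nonneg_nonpos) (auto simp: damping_def R_def)
  then show "bilin (Suc n) Q x x \<le> 0" using Q_00_pos by (simp add: mult_le_0_iff)
qed (simp add: bilin_e0 Q_00_pos)

text \<open>
  For \<open>T = {}\<close> the damping factor takes effect and \<open>R\<close> contains all indices except \<open>0\<close>, so no row of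
  \<open>Q\<close> vanishes.
\<close>

lemma strictly_hyperbolic_Q:
  assumes "T = {}" "s < 1"
  shows "strictly_hyperbolic (Suc n) Q"
proof (rule strictly_hyperbolic_if_complement_neg[OF symmetric_Q, of "\<lambda>i. of_bool (i = 0)"])
  fix x assume x: "bilin (Suc n) Q x (\<lambda>i. of_bool (i = 0)) = 0" and nz: "\<exists>i<Suc n. x i \<noteq> 0"
  have R: "R = {1..n}" using assms by (simp add: R_def)
  have ex: "\<exists>i\<in>R. weight (insert i T) * x i \<noteq> 0"
  proof (rule ccontr)
    assume *: "\<not> ?thesis"
    have z: "x i = 0" if "i \<in> {1..n}" for i
    proof -
      have "weight (insert i T) * x i = 0" using * that R by blast
      then show ?thesis using weight_pos[of "insert i T"] by simp
    qed
    then have "Q 0 0 * x 0 = 0"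
      unfolding bilin_complete_square(2)[OF symmetric_Q x] by simp
    then have "x 0 = 0" using Q_00_pos by simp
    then have "x i = 0" if "i < Suc n" for i
      using z[of i] that by (cases "i = 0") auto
    with nz show False by blast
  qed
  have "Q 0 0 * bilin (Suc n) Q x x < 0"
    unfolding bilin_complete_square(1)[OF symmetric_Q x] discriminant
    using pair_sum_less[of T R "damping s T" "\<lambda>i. weight (insert i T) * x i"] T_subset card_R s assms ex
    by (intro mult_pos_neg) (auto simp: damping_def R_def)
  then show "bilin (Suc n) Q x x < 0" using Q_00_pos by (simp add: mult_less_0_iff)
qed (simp add: bilin_e0 Q_00_pos)

end

lemma squarefree_part_if_normalized_coeff_nonzero:
  assumes "n \<ge> 2" "i < Suc n" "j < Suc n" "normalized_coeff s (m + unit_exp i + unit_exp j) \<noteq> 0"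
  shows "squarefree_part n (n - 2) m"
proof -
  have n_eq: "n = Suc (Suc (n - 2))" using assms(1) by simp
  have drop: "squarefree_part n d m'" if "squarefree_part n (Suc d) (m' + unit_exp l)" "l < Suc n" for d m' l
    using that squarefree_part_add_0[of n d m'] squarefree_part_add[of l n d m'] by (cases "l = 0") auto
  have "squarefree_part n (Suc (Suc (n - 2))) (m + unit_exp i + unit_exp j)"
    using assms(4) unfolding n_eq[symmetric] by (simp add: normalized_coeff_def split: if_splits)
  then show ?thesis using drop assms(2,3) by blast
qed

lemma coord_hyperbolic_normalized_coeff:
  assumes s: "0 < s" "s \<le> 1" and n: "n \<ge> 2"
  shows "coord_hyperbolic (Suc n) k (normalized_coeff s)"
proof (rule coord_hyperbolicI)
  fix m
  show "hyperbolic (Suc n) (\<lambda>i j. normalized_coeff s (m + unit_exp i + unit_exp j))"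
  proof (cases "squarefree_part n (n - 2) m")
    case True
    then show ?thesis using hyperbolic_Q[OF s True n] by simp
  next
    case False
    then have "bilin (Suc n) (\<lambda>i j. normalized_coeff s (m + unit_exp i + unit_exp j)) x y = 0" for x y
      unfolding bilin_def using squarefree_part_if_normalized_coeff_nonzero[OF n]
      by (intro sum.neutral ballI) auto
    then show ?thesis by (simp add: hyperbolic_def)
  qed
qed

lemma strictly_hyperbolic_at_0_normalized_coeff:
  assumes s: "0 < s" "s < 1" and n: "n \<ge> 2"
  shows "strictly_hyperbolic_at_0 (Suc n) (n - 2) (normalized_coeff s)"
proof (rule strictly_hyperbolic_at_0I)
  have supp: "supp (Poly_Mapping.single 0 (n - 2)) = {}"
    by (auto simp: supp_def)
  then have "squarefree_part n (n - 2) (Poly_Mapping.single 0 (n - 2))"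
    by (simp add: squarefree_part_def)
  from strictly_hyperbolic_Q[OF s(1) _ this n supp s(2)] s
  show "strictly_hyperbolic (Suc n)
      (\<lambda>i j. normalized_coeff s (Poly_Mapping.single 0 (n - 2) + unit_exp i + unit_exp j))"
    by simp
qed

end


section \<open>Monomials as words\<close>

text \<open>
  Words in the variables are the form in which iterated derivatives arrive; a word stands for the
  product of its letters.
\<close>

definition monomial_of_word :: "nat list \<Rightarrow> monomial" where
  "monomial_of_word xs = sum_list (map unit_exp xs)"

definition monomial_fact :: "monomial \<Rightarrow> real" where
  "monomial_fact m = (\<Prod>i\<in>Poly_Mapping.keys m. fact (Poly_Mapping.lookup m i))"

lemma monomial_of_word_simps [simp]: "monomial_of_word [] = 0" "monomial_of_word (x # xs) = unit_exp x + monomial_of_word xs"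
  by (simp_all add: monomial_of_word_def)

lemma lookup_monomial_of_word: "Poly_Mapping.lookup (monomial_of_word xs) i = count (mset xs) i"
  by (induction xs) (auto simp: lookup_add lookup_unit_exp)

lemma mset_eq_iff_monomial_of_word_eq: "mset xs = mset ys \<longleftrightarrow> monomial_of_word xs = monomial_of_word ys"
  by (auto simp: multiset_eq_iff poly_mapping_eq_iff fun_eq_iff simp flip: lookup_monomial_of_word)

lemma ex_monomial_of_word: "\<exists>xs. monomial_of_word xs = m"
proof -
  have "finite {i. 0 < Poly_Mapping.lookup m i}"
    using finite_keys[of m] by (simp add: keys.rep_eq)
  then have "count (Abs_multiset (Poly_Mapping.lookup m)) = Poly_Mapping.lookup m"
    by (rule count_Abs_multiset)
  moreover obtain xs where "mset xs = Abs_multiset (Poly_Mapping.lookup m)"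
    using ex_mset by blast
  ultimately have "monomial_of_word xs = m"
    by (intro poly_mapping_eqI) (simp add: lookup_monomial_of_word)
  then show ?thesis by blast
qed

lemma monomial_of_word_in_monomials_iff:
  "monomial_of_word xs \<in> monomials N d \<longleftrightarrow> set xs \<subseteq> {..<N} \<and> length xs = d"
proof -
  have keys: "Poly_Mapping.keys (monomial_of_word xs) = set xs"
    by (auto simp: in_keys_iff lookup_monomial_of_word)
  have "(\<Sum>i\<in>set xs. Poly_Mapping.lookup (monomial_of_word xs) i) = length xs"
    unfolding lookup_monomial_of_word using size_multiset_overloaded_eq[of "mset xs"] by simp
  then show ?thesis by (simp add: monomials_def keys)
qed

lemma finite_monomials: "finite (monomials N d)"
proof -
  have "monomials N d \<subseteq> monomial_of_word ` {xs. set xs \<subseteq> {..<N} \<and> length xs = d}"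
  proof
    fix m assume m: "m \<in> monomials N d"
    obtain xs where "monomial_of_word xs = m" using ex_monomial_of_word by blast
    with m show "m \<in> monomial_of_word ` {xs. set xs \<subseteq> {..<N} \<and> length xs = d}"
      by (auto simp: monomial_of_word_in_monomials_iff)
  qed
  then show ?thesis using finite_lists_length_eq[of "{..<N}" d] finite_surj by blast
qed

lemma monomial_fact_pos: "monomial_fact m > 0"
  by (simp add: monomial_fact_def prod_pos)

lemma monomial_fact_add: "monomial_fact (m + unit_exp i) = real (Suc (Poly_Mapping.lookup m i)) * monomial_fact m"
proof -
  define A where "A = insert i (Poly_Mapping.keys m)"
  have A: "finite A" "i \<in> A" by (auto simp: A_def)
  have ext: "monomial_fact m' = (\<Prod>j\<in>A. fact (Poly_Mapping.lookup m' j))" if "Poly_Mapping.keys m' \<subseteq> A" for m'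
    unfolding monomial_fact_def using A that by (intro prod.mono_neutral_left) (auto simp: in_keys_iff)
  have "monomial_fact (m + unit_exp i) = (\<Prod>j\<in>A. fact (Poly_Mapping.lookup (m + unit_exp i) j))"
    by (rule ext) (auto simp: A_def in_keys_iff lookup_add lookup_unit_exp)
  also have "\<dots> = fact (Suc (Poly_Mapping.lookup m i)) * (\<Prod>j\<in>A - {i}. fact (Poly_Mapping.lookup m j))"
    using A by (subst prod.remove[of A i]) (auto simp: lookup_add lookup_unit_exp intro!: prod.cong)
  also have "\<dots> = real (Suc (Poly_Mapping.lookup m i)) * (\<Prod>j\<in>A. fact (Poly_Mapping.lookup m j))"
    unfolding prod.remove[OF A, of "\<lambda>j. fact (Poly_Mapping.lookup m j) :: real"] by simp
  also have "(\<Prod>j\<in>A. fact (Poly_Mapping.lookup m j)) = monomial_fact m"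
    by (rule ext[symmetric]) (auto simp: A_def)
  finally show ?thesis .
qed

text \<open>
  Multiplied by the factorials of the exponents, coefficients are merely shifted by differentiation.
\<close>

lemma coeff_foldr_pdiff:
  "monomial_fact m * Defs.coeff (foldr pdiff xs h) m =
    monomial_fact (m + monomial_of_word xs) * Defs.coeff h (m + monomial_of_word xs)"
proof (induction xs arbitrary: m)
  case (Cons x xs)
  have "monomial_fact m * Defs.coeff (foldr pdiff (x # xs) h) m =
      monomial_fact (m + unit_exp x) * Defs.coeff (foldr pdiff xs h) (m + unit_exp x)"
    by (simp add: lookup_pdiff[folded unit_exp_def] monomial_fact_add)
  also have "\<dots> = monomial_fact (m + unit_exp x + monomial_of_word xs) * Defs.coeff h (m + unit_exp x + monomial_of_word xs)"
    by (rule Cons.IH)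
  finally show ?case by (simp add: add.assoc)
qed simp


section \<open>Strictly Lorentzian perturbations\<close>

text \<open>
  The polynomial \<open>w \<mapsto> h (\<Sum>\<^sub>i w\<^sub>i a\<^sub>i)\<close> of degree \<open>d\<close>, where \<open>g\<close> gives the normalized coefficients of
  \<open>h\<close>: by the chain rule, its normalized coefficient at a product of variables is the iterated
  derivative of \<open>h\<close> in the corresponding directions \<open>a\<^sub>i\<close>. The choice of the word is immaterial
  because derivatives commute.
\<close>

definition substitute :: "nat \<Rightarrow> nat \<Rightarrow> (nat \<Rightarrow> nat \<Rightarrow> real) \<Rightarrow> (monomial \<Rightarrow> real) \<Rightarrow> real_mpoly" where
  "substitute N d a g = (\<Sum>m\<in>monomials N d.
     Poly_Mapping.single m (fold (dirderiv N) (map a (SOME xs. monomial_of_word xs = m)) g 0 / monomial_fact m))"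

lemma coeff_substitute_eq_0: "m \<notin> monomials N d \<Longrightarrow> Defs.coeff (substitute N d a g) m = 0"
  unfolding substitute_def lookup_sum lookup_single by (intro sum.neutral) (auto simp: when_def)

lemma fold_dirderiv_cong:
  assumes "mset vs = mset ws"
  shows "fold (dirderiv N) vs g = fold (dirderiv N) ws g"
  using assms by (rule fold_permuted_eq[where P = "\<lambda>_. True"]) (auto intro: dirderiv_commute)

lemma coeff_substitute:
  assumes "set xs \<subseteq> {..<N}" "length xs = d"
  shows "monomial_fact (monomial_of_word xs) * Defs.coeff (substitute N d a g) (monomial_of_word xs) =
    fold (dirderiv N) (map a xs) g 0"
proof -
  define ys where "ys = (SOME ys. monomial_of_word ys = monomial_of_word xs)"
  have "monomial_of_word ys = monomial_of_word xs" unfolding ys_def by (rule someI_ex[OF ex_monomial_of_word])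
  then have "mset (map a ys) = mset (map a xs)"
    by (simp only: mset_eq_iff_monomial_of_word_eq[symmetric] mset_map)
  then have "fold (dirderiv N) (map a ys) g = fold (dirderiv N) (map a xs) g"
    by (rule fold_dirderiv_cong)
  moreover have "Defs.coeff (substitute N d a g) (monomial_of_word xs) =
      fold (dirderiv N) (map a ys) g 0 / monomial_fact (monomial_of_word xs)"
    unfolding substitute_def lookup_sum lookup_single
    using finite_monomials[of N d] assms monomial_of_word_in_monomials_iff[of xs N d]
    by (subst sum.remove[of _ "monomial_of_word xs"]) (auto simp: when_def ys_def intro!: sum.neutral)
  ultimately show ?thesis using monomial_fact_pos[of "monomial_of_word xs"] by simp
qed

lemma coeff_foldr_pdiff_substitute:
  assumes "set xs \<subseteq> {..<N}" "length xs = d"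
  shows "Defs.coeff (foldr pdiff xs (substitute N d a g)) 0 = fold (dirderiv N) (map a xs) g 0"
  using coeff_foldr_pdiff[of 0 xs "substitute N d a g"] coeff_substitute[OF assms]
  by (simp add: monomial_fact_def)

lemma fold_dirderiv_pos:
  assumes "star_positive N g" "0 < N" "\<And>a i. a \<in> set as \<Longrightarrow> i < N \<Longrightarrow> a i > 0"
    and "g (Poly_Mapping.single 0 (r + length as)) > 0"
  shows "fold (dirderiv N) as g (Poly_Mapping.single 0 r) > 0"
  using assms
proof (induction as arbitrary: g)
  case (Cons a as)
  have a: "i < N \<Longrightarrow> 0 < a i" for i using Cons.prems(3) by simp
  have "0 < a 0 * g (Poly_Mapping.single 0 (r + length as) + unit_exp 0)"
    using a Cons.prems(2,4) by (simp add: unit_exp_def flip: single_add)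
  also have "\<dots> \<le> dirderiv N a g (Poly_Mapping.single 0 (r + length as))"
    unfolding dirderiv_def using a Cons.prems(1,2)
    by (intro member_le_sum[of 0 _ "\<lambda>j. a j * g (Poly_Mapping.single 0 (r + length as) + unit_exp j)"])
      (auto simp: star_positive_def less_imp_le)
  finally have "0 < dirderiv N a g (Poly_Mapping.single 0 (r + length as))" .
  moreover have "star_positive N (dirderiv N a g)"
    using Cons.prems(1) a by (intro star_positive_dirderiv) (auto simp: less_imp_le)
  ultimately show ?case using Cons.prems by (simp add: Cons.IH)
qed simp

definition perturbed_basis :: "real \<Rightarrow> nat \<Rightarrow> nat \<Rightarrow> real" where
  "perturbed_basis \<epsilon> i k = of_bool (i = k) + \<epsilon>"

text \<open>
  If \<open>x + \<epsilon> (\<Sum> x\<^sub>i) (1, \<dots>, 1) = 0\<close>, then taking the sum of all entries gives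
  \<open>(1 + N \<epsilon>) \<Sum> x\<^sub>i = 0\<close>.
\<close>

lemma perturbed_basis_injective:
  assumes "\<epsilon> > 0" and "\<And>k. k < N \<Longrightarrow> (\<Sum>i<N. x i * perturbed_basis \<epsilon> i k) = 0" and i: "i < N"
  shows "x i = 0"
proof -
  define S where "S = (\<Sum>i<N. x i)"
  have x: "x k = - (\<epsilon> * S)" if k: "k < N" for k
  proof -
    have "(\<Sum>i<N. x i * perturbed_basis \<epsilon> i k) = (\<Sum>i<N. x i * of_bool (i = k)) + \<epsilon> * S"
      by (simp add: perturbed_basis_def S_def sum.distrib sum_distrib_left algebra_simps)
    also have "(\<Sum>i<N. x i * of_bool (i = k)) = x k"
      using k by (subst sum.remove[of _ k]) (auto intro!: sum.neutral)
    finally show ?thesis using assms(2)[OF k] by simp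
  qed
  have "S = (\<Sum>k<N. x k)" by (rule S_def)
  also have "\<dots> = (\<Sum>k<N. - (\<epsilon> * S))" by (rule sum.cong) (simp_all add: x)
  finally have "S * (1 + N * \<epsilon>) = 0" by (simp add: algebra_simps)
  moreover have "1 + N * \<epsilon> > 0" using assms(1) by (simp add: add_pos_nonneg)
  ultimately have "S = 0" by simp
  then show ?thesis using x[OF i] by simp
qed

text \<open>
  The iterated coordinate derivatives of the substituted polynomial are derivatives of the original one
  in positive directions, pulled back along the same invertible substitution.
\<close>

lemma strictly_lorentzian_substitute:
  assumes star: "star_positive N g" and N: "0 < N" and top: "g (Poly_Mapping.single 0 d) > 0"
    and coord: "d \<ge> 2 \<Longrightarrow> coord_hyperbolic N (d - 2) g"
    and strict: "d \<ge> 2 \<Longrightarrow> strictly_hyperbolic_at_0 N (d - 2) g"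
    and \<epsilon>: "\<epsilon> > 0"
  shows "strictly_lorentzian N d (substitute N d (perturbed_basis \<epsilon>) g)"
proof -
  let ?a = "perturbed_basis \<epsilon>"
  let ?H = "substitute N d ?a g"
  have a: "?a i k > 0" for i k using \<epsilon> by (simp add: perturbed_basis_def)
  have "homogeneous N d ?H"
    unfolding homogeneous_def
  proof
    fix m assume "m \<in> Poly_Mapping.keys ?H"
    then show "m \<in> monomials N d"
      using coeff_substitute_eq_0[of m N d ?a g] by (auto simp: in_keys_iff)
  qed
  moreover have "Defs.coeff ?H m > 0" if m: "m \<in> monomials N d" for m
  proof -
    obtain xs where xs: "monomial_of_word xs = m" using ex_monomial_of_word by blast
    have l: "set xs \<subseteq> {..<N}" "length xs = d"
      using m unfolding xs[symmetric] monomial_of_word_in_monomials_iff by auto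
    have "fold (dirderiv N) (map ?a xs) g (Poly_Mapping.single 0 0) > 0"
      using a l by (intro fold_dirderiv_pos star N) (auto simp: top)
    then have "monomial_fact m * Defs.coeff ?H m > 0"
      using coeff_substitute[OF l, of ?a g] by (simp add: xs)
    then show ?thesis using monomial_fact_pos[of m] by (simp add: zero_less_mult_iff)
  qed
  moreover have "has_signature N (foldr pdiff is ?H) 1 (N - 1)"
    if "is": "length is + 2 = d" "set is \<subseteq> {..<N}" for "is"
  proof (rule has_signature_if_strictly_hyperbolic)
    define G where "G = fold (dirderiv N) (map ?a is) g"
    let ?Q = "\<lambda>i j. (1 / 2) * bilin N (hessian G) (?a i) (?a j)"
    have d: "d \<ge> 2" "d - 2 = length (map ?a is)" using "is" by auto
    have G: "strictly_hyperbolic N (hessian G)"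
      unfolding G_def using a N star coord[OF d(1)] strict[OF d(1)] unfolding d(2)
      by (intro strictly_hyperbolic_iterated_dirderiv) auto
    have entry: "Defs.coeff (pdiff i (pdiff j (foldr pdiff is ?H))) 0 = bilin N (hessian G) (?a i) (?a j)"
      if "i < N" "j < N" for i j
    proof -
      have "Defs.coeff (pdiff i (pdiff j (foldr pdiff is ?H))) 0 = Defs.coeff (foldr pdiff (i # j # is) ?H) 0"
        by simp
      also have "\<dots> = fold (dirderiv N) (map ?a (i # j # is)) g 0"
        using that "is" by (intro coeff_foldr_pdiff_substitute) auto
      also have "\<dots> = fold (dirderiv N) (map ?a (is @ [j, i])) g 0"
        by (rule arg_cong[OF fold_dirderiv_cong, of _ _ "\<lambda>h. h 0"]) simp
      also have "\<dots> = dirderiv N (?a i) (dirderiv N (?a j) G) 0"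
        by (simp add: G_def)
      also have "\<dots> = bilin N (hessian G) (?a i) (?a j)"
        by (simp add: dirderiv_def bilin_def hessian_def sum_distrib_left mult_ac)
      finally show ?thesis .
    qed
    show "gram_mat N (foldr pdiff is ?H) = mat N N (\<lambda>(i, j). ?Q i j)"
      unfolding gram_mat_def using entry by (intro eq_matI) auto
    show "symmetric N ?Q"
      using bilin_commute[OF symmetric_hessian] by (auto simp: symmetric_def)
    show "strictly_hyperbolic N ?Q"
      by (rule strictly_hyperbolic_pullback[OF G])
        (use perturbed_basis_injective[OF \<epsilon>] in auto)
    have starG: "star_positive N G"
      unfolding G_def using star a
    proof (induction "is" arbitrary: g)
      case (Cons i "is")
      have "star_positive N (dirderiv N (?a i) g)"
        using Cons.prems(2) by (intro star_positive_dirderiv[OF Cons.prems(1)]) (auto simp: less_imp_le)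
      then show ?case using Cons by simp
    qed simp
    have "fold (dirderiv N) (map ?a is) g (Poly_Mapping.single 0 2) > 0"
      using a "is" top by (intro fold_dirderiv_pos star N) (auto simp: add.commute)
    moreover have "unit_exp 0 + unit_exp 0 = Poly_Mapping.single 0 2"
      by (simp only: unit_exp_def single_add[symmetric] one_add_one)
    ultimately have "hessian G 0 0 > 0"
      unfolding hessian_def G_def by (simp only:)
    then have "0 < hessian G 0 0 * ?a 0 0 * ?a 0 0" using a by simp
    also have "\<dots> \<le> (\<Sum>j<N. hessian G 0 j * ?a 0 0 * ?a 0 j)"
      using N a starG by (intro member_le_sum) (auto simp: star_positive_def hessian_def less_imp_le)
    also have "\<dots> \<le> bilin N (hessian G) (?a 0) (?a 0)"
      unfolding bilin_def using N a starG
      by (intro member_le_sum[of 0 _ "\<lambda>i. \<Sum>j<N. hessian G i j * ?a 0 i * ?a 0 j"])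
        (auto intro!: sum_nonneg simp: star_positive_def hessian_def less_imp_le)
    finally have "0 < bilin N (hessian G) (?a 0) (?a 0)" .
    then show "0 < bilin N ?Q (\<lambda>i. of_bool (i = 0)) (\<lambda>i. of_bool (i = 0))"
      by (simp add: bilin_e0[OF N])
  qed
  ultimately show ?thesis unfolding strictly_lorentzian_def by blast
qed

text \<open>
  In the limit the directions are the coordinate vectors, and derivatives in these are shifts.
\<close>

lemma fold_dirderiv_tendsto:
  assumes "\<epsilon> \<longlonglongrightarrow> 0" and "\<And>m. (\<lambda>k. g k m) \<longlonglongrightarrow> h m" and "set xs \<subseteq> {..<N}"
  shows "(\<lambda>k. fold (dirderiv N) (map (perturbed_basis (\<epsilon> k)) xs) (g k) m) \<longlonglongrightarrow> h (m + monomial_of_word xs)"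
  using assms(2,3)
proof (induction xs arbitrary: g h)
  case (Cons x xs)
  have lim: "(\<lambda>k. dirderiv N (perturbed_basis (\<epsilon> k) x) (g k) m) \<longlonglongrightarrow> h (m + unit_exp x)" for m
  proof -
    have "(\<lambda>k. dirderiv N (perturbed_basis (\<epsilon> k) x) (g k) m)
        \<longlonglongrightarrow> (\<Sum>j<N. (of_bool (x = j) + 0) * h (m + unit_exp j))"
      unfolding dirderiv_def perturbed_basis_def
      by (intro tendsto_sum tendsto_mult tendsto_add tendsto_const assms(1) Cons.prems(1))
    also have "(\<Sum>j<N. (of_bool (x = j) + 0) * h (m + unit_exp j)) = h (m + unit_exp x)"
      using Cons.prems(2) by (subst sum.remove[of _ x]) (auto intro!: sum.neutral)
    finally show ?thesis .
  qed
  then show ?case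
    using Cons.prems(2) Cons.IH[of "\<lambda>k. dirderiv N (perturbed_basis (\<epsilon> k) x) (g k)"
        "\<lambda>m. h (m + unit_exp x)", OF lim]
    by (simp add: add_ac)
qed simp

lemma coeff_substitute_tendsto:
  assumes "\<epsilon> \<longlonglongrightarrow> 0" and "\<And>m. (\<lambda>k. g k m) \<longlonglongrightarrow> h m" and m: "m \<in> monomials N d"
  shows "(\<lambda>k. Defs.coeff (substitute N d (perturbed_basis (\<epsilon> k)) (g k)) m) \<longlonglongrightarrow> h m / monomial_fact m"
proof -
  obtain xs where xs: "monomial_of_word xs = m" using ex_monomial_of_word by blast
  have l: "set xs \<subseteq> {..<N}" "length xs = d"
    using m unfolding xs[symmetric] monomial_of_word_in_monomials_iff by auto
  have "Defs.coeff (substitute N d a g) m = fold (dirderiv N) (map a xs) g 0 / monomial_fact m" for a g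
    using coeff_substitute[OF l, of a g] monomial_fact_pos[of m] by (simp add: xs field_simps)
  moreover have "(\<lambda>k. fold (dirderiv N) (map (perturbed_basis (\<epsilon> k)) xs) (g k) 0) \<longlonglongrightarrow> h (0 + monomial_of_word xs)"
    by (rule fold_dirderiv_tendsto[OF assms(1,2) l(1)])
  ultimately show ?thesis
    using monomial_fact_pos[of m] by (auto simp: xs intro!: tendsto_divide tendsto_const)
qed


section \<open>The partition function of a morphism\<close>

definition squarefree_mon :: "nat \<Rightarrow> nat set \<Rightarrow> monomial" where
  "squarefree_mon n S = Poly_Mapping.single 0 (n - card S) + (\<Sum>i\<in>S. unit_exp i)"

lemma lookup_squarefree_mon:
  assumes "S \<subseteq> {1..n}"
  shows "Poly_Mapping.lookup (squarefree_mon n S) i = (if i = 0 then n - card S else of_bool (i \<in> S))"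
proof -
  have S: "finite S" using assms finite_subset by blast
  have "Poly_Mapping.lookup (\<Sum>i\<in>S. unit_exp i) i = of_bool (i \<in> S)"
    using S by (induction S rule: finite_induct) (auto simp: lookup_add lookup_unit_exp)
  then show ?thesis
    using assms by (auto simp: squarefree_mon_def lookup_add lookup_single when_def)
qed

lemma squarefree_mon_eq_iff:
  assumes S: "S \<subseteq> {1..n}"
  shows "squarefree_mon n S = m \<longleftrightarrow> squarefree_part n n m \<and> S = supp m"
proof
  assume m: "squarefree_mon n S = m"
  have "supp m = S"
    using S unfolding m[symmetric] supp_def by (auto simp: in_keys_iff lookup_squarefree_mon[OF S] split: if_splits)
  moreover have "card S \<le> n" using card_mono[OF _ S] by simp
  ultimately show "squarefree_part n n m \<and> S = supp m"
    using S lookup_squarefree_mon[OF S] by (auto simp: squarefree_part_def m)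
next
  assume m: "squarefree_part n n m \<and> S = supp m"
  show "squarefree_mon n S = m"
  proof (rule poly_mapping_eqI)
    fix i
    have "i \<noteq> 0 \<Longrightarrow> i \<notin> S \<Longrightarrow> Poly_Mapping.lookup m i = 0"
      using m by (auto simp: supp_def in_keys_iff)
    moreover have "Poly_Mapping.lookup m 0 = n - card S" "i \<in> S \<Longrightarrow> Poly_Mapping.lookup m i = 1"
      using m by (auto simp: squarefree_part_def)
    ultimately show "Poly_Mapping.lookup (squarefree_mon n S) i = Poly_Mapping.lookup m i"
      by (auto simp: lookup_squarefree_mon[OF S])
  qed
qed

lemma squarefree_part_in_monomials:
  assumes "squarefree_part n n m"
  shows "m \<in> monomials (n + 1) n"
proof -
  have fin: "finite (supp m)" "0 \<notin> supp m" by (auto simp: supp_def)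
  have sub: "Poly_Mapping.keys m \<subseteq> insert 0 (supp m)" by (auto simp: supp_def)
  then have "(\<Sum>i\<in>Poly_Mapping.keys m. Poly_Mapping.lookup m i) =
      (\<Sum>i\<in>insert 0 (supp m). Poly_Mapping.lookup m i)"
    using fin by (intro sum.mono_neutral_left) (auto simp: in_keys_iff)
  also have "\<dots> = n"
    using assms fin by (simp add: squarefree_part_def)
  finally show ?thesis
    using assms sub by (fastforce simp: monomials_def squarefree_part_def)
qed

lemma monomial_fact_squarefree:
  assumes "squarefree_part n n m"
  shows "monomial_fact m = fact (Poly_Mapping.lookup m 0)"
proof -
  have fin: "finite (supp m)" "0 \<notin> supp m" by (auto simp: supp_def)
  have "monomial_fact m = (\<Prod>i\<in>insert 0 (supp m). fact (Poly_Mapping.lookup m i))"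
    unfolding monomial_fact_def using fin
    by (intro prod.mono_neutral_left) (auto simp: in_keys_iff supp_def)
  also have "\<dots> = fact (Poly_Mapping.lookup m 0)"
    using assms fin by (simp add: squarefree_part_def)
  finally show ?thesis .
qed

lemma Var_power: "Var i ^ k = Poly_Mapping.single (Poly_Mapping.single i k) 1"
  by (induction k) (auto simp: Var_def mult_single single_add[symmetric] simp flip: single_one)

lemma prod_Var:
  assumes "finite S"
  shows "(\<Prod>i\<in>S. Var i) = Poly_Mapping.single (\<Sum>i\<in>S. unit_exp i) 1"
  using assms by (induction S rule: finite_induct) (auto simp: Var_def mult_single unit_exp_def)

lemma coeff_Z_morphism:
  "Defs.coeff (Z_morphism p q n r r' f) m =
    (if squarefree_part n n m
     then p powi (- int (r (supp m))) * q powi (- int (r' (f ` supp m))) else 0)"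
proof -
  let ?w = "\<lambda>S. p powi (- int (r S)) * q powi (- int (r' (f ` S)))"
  have "Const (?w S) * Var 0 ^ (n - card S) * (\<Prod>i\<in>S. Var i) =
      Poly_Mapping.single (squarefree_mon n S) (?w S)" if "S \<in> Pow {1..n}" for S
    using that finite_subset[of S "{1..n}"]
    by (simp add: Const_def Var_power prod_Var mult_single squarefree_mon_def)
  then have "Defs.coeff (Z_morphism p q n r r' f) m =
      (\<Sum>S\<in>Pow {1..n}. Defs.coeff (Poly_Mapping.single (squarefree_mon n S) (?w S)) m)"
    unfolding Z_morphism_def lookup_sum by (intro sum.cong refl) simp
  also have "\<dots> = (\<Sum>S\<in>Pow {1..n}. if squarefree_part n n m \<and> S = supp m then ?w S else 0)"
    by (intro sum.cong refl) (auto simp: lookup_single when_def squarefree_mon_eq_iff)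
  also have "\<dots> = (if squarefree_part n n m then ?w (supp m) else 0)"
  proof (cases "squarefree_part n n m")
    case True
    then have "supp m \<in> Pow {1..n}" by (simp add: squarefree_part_def)
    with True show ?thesis by (simp add: sum.delta)
  qed simp
  finally show ?thesis .
qed

theorem theorem1p7:
  fixes n :: nat and F :: "'b set"
    and rk\<^sub>M :: "nat set \<Rightarrow> nat" and rk\<^sub>N :: "'b set \<Rightarrow> nat"
    and f :: "nat \<Rightarrow> 'b" and p q :: real
  assumes "matroid {1..n} rk\<^sub>M"
    and "matroid F rk\<^sub>N"
    and "matroid_morphism {1..n} rk\<^sub>M F rk\<^sub>N f"
    and "0 < p" and "p \<le> 1" and "0 < q" and "q \<le> 1"
  shows "lorentzian (n + 1) n (Z_morphism p q n rk\<^sub>M rk\<^sub>N f)"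
proof -
  interpret f: matroid_morphism "{1..n}" rk\<^sub>M F rk\<^sub>N f by fact
  define r2 where "r2 = (\<lambda>S. rk\<^sub>N (f ` S))"
  have "matroid {1..n} r2"
    unfolding r2_def using assms(2) f.maps_to by (intro matroid_pullback[where F = F]) auto
  moreover have "r2 S' + rk\<^sub>M S \<le> rk\<^sub>M S' + r2 S" if "S \<subseteq> S'" "S' \<subseteq> {1..n}" for S S'
    using f.rk_diff[OF that] by (simp add: r2_def)
  ultimately interpret quotient_on_interval n rk\<^sub>M r2 p q
    using assms unfolding quotient_on_interval_def matroid_quotient_def matroid_quotient_axioms_def
    by blast
  define \<epsilon> where "\<epsilon> = (\<lambda>k. 1 / real (Suc k))"
  define s where "s = (\<lambda>k. 1 - 1 / real (Suc (Suc k)))"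
  define H where "H = (\<lambda>k. substitute (n + 1) n (perturbed_basis (\<epsilon> k)) (normalized_coeff (s k)))"
  have s: "0 < s k" "s k < 1" for k by (simp_all add: s_def)
  have "strictly_lorentzian (n + 1) n (H k)" for k
    unfolding H_def
  proof (rule strictly_lorentzian_substitute)
    show "star_positive (n + 1) (normalized_coeff (s k))" using star_positive_normalized_coeff[OF s(1)] by simp
    have "supp (Poly_Mapping.single 0 n) = {}" by (auto simp: supp_def)
    then have "squarefree_part n n (Poly_Mapping.single 0 n)" by (simp add: squarefree_part_def)
    then show "normalized_coeff (s k) (Poly_Mapping.single 0 n) > 0" by (simp only: normalized_coeff_pos_iff[OF s(1)])
    show "coord_hyperbolic (n + 1) (n - 2) (normalized_coeff (s k))" if "n \<ge> 2"
      using coord_hyperbolic_normalized_coeff[OF s(1) less_imp_le[OF s(2)] that] by simp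
    show "strictly_hyperbolic_at_0 (n + 1) (n - 2) (normalized_coeff (s k))" if "n \<ge> 2"
      using strictly_hyperbolic_at_0_normalized_coeff[OF s that] by simp
  qed (simp_all add: \<epsilon>_def)
  moreover have "(\<lambda>k. Defs.coeff (H k) m) \<longlonglongrightarrow> Defs.coeff (Z_morphism p q n rk\<^sub>M rk\<^sub>N f) m" for m
  proof (cases "m \<in> monomials (n + 1) n")
    case True
    have "\<epsilon> \<longlonglongrightarrow> 0" unfolding \<epsilon>_def using LIMSEQ_inverse_real_of_nat by (simp add: inverse_eq_divide)
    moreover have "(\<lambda>k. normalized_coeff (s k) m) \<longlonglongrightarrow> normalized_coeff 1 m" for m
    proof -
      have "(\<lambda>k. 1 / real (Suc (Suc k))) \<longlonglongrightarrow> 0"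
        using LIMSEQ_Suc[OF LIMSEQ_inverse_real_of_nat] by (simp add: inverse_eq_divide)
      then have "s \<longlonglongrightarrow> 1 - 0" unfolding s_def by (intro tendsto_diff tendsto_const)
      then have "(\<lambda>k. damping (s k) S) \<longlonglongrightarrow> damping 1 S" for S
        by (cases "S = {}") (simp_all add: damping_def)
      then show ?thesis unfolding normalized_coeff_def by (auto intro!: tendsto_mult tendsto_const)
    qed
    ultimately have "(\<lambda>k. Defs.coeff (H k) m) \<longlonglongrightarrow> normalized_coeff 1 m / monomial_fact m"
      unfolding H_def using True by (intro coeff_substitute_tendsto)
    also have "normalized_coeff 1 m / monomial_fact m = Defs.coeff (Z_morphism p q n rk\<^sub>M rk\<^sub>N f) m"
      unfolding normalized_coeff_def weight_def coeff_Z_morphism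
      by (simp add: monomial_fact_squarefree damping_def r2_def)
    finally show ?thesis .
  next
    case False
    then have "\<not> squarefree_part n n m" using squarefree_part_in_monomials by blast
    then show ?thesis
      using False by (simp add: H_def coeff_substitute_eq_0 coeff_Z_morphism)
  qed
  ultimately show ?thesis unfolding lorentzian_def by blast
qed

end
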